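(* Let $C_0 \approx 13.901$ be the constant described in the context. Then, as $t \to \infty$, \[R_2(2,t) = O\big(t\, 6^{t/4}\big) \qquad\text{and}\qquad R_3(2,t) = O\big(t\, C_0^{t}\big).\]
   Context: For a finite field $\mathbb F_q$ and positive integers $s,t$, $R_q(s,t)$ denotes the minimum $n$ such that for every red-blue coloring of the $1$-dimensional linear subspaces of $\mathbb F_q^n$, there is either a linear subspace of dimension $s$ all of whose $1$-dimensional subspaces are red, or a linear subspace of dimension $t$ all of whose $1$-dimensional subspaces are blue. The constant $C_0 \approx 13.901$ is the absolute constant $C_0 = 1 + 1/(1-\log_3 \gamma)$ with $\gamma = \min_{0<x<1}(1+x+x^2)/x^{2/3} \approx 2.7552$ (the constant of Fox–Pham's theorem on affine subspaces in dense subsets of $\mathbb F_3^n$); it has the known property that every $A \subseteq \mathbb F_3^n$ with $|A| = \alpha 3^n$ contains at least $\alpha^{C_0} 3^{2n}$ triples of the form $(x, x+d, x+2d)$ with $x,d \in \mathbb F_3^n$. *)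

theory Defs
  imports "HOL-Analysis.Analysis" "HOL-Library.Landau_Symbols"
begin

text \<open>Vectors of \<open>F^n\<close> over a field type 'a: functions nat \<Rightarrow> 'a vanishing at indices \<ge> n.\<close>

definition fvec :: "nat \<Rightarrow> (nat \<Rightarrow> 'a::field) set" where
  "fvec n = {v. \<forall>i\<ge>n. v i = 0}"

definition vscale :: "'a::field \<Rightarrow> (nat \<Rightarrow> 'a) \<Rightarrow> (nat \<Rightarrow> 'a)" where
  "vscale c v = (\<lambda>i. c * v i)"

definition vzero :: "nat \<Rightarrow> 'a::field" where
  "vzero = (\<lambda>i. 0)"

definition vadd :: "(nat \<Rightarrow> 'a::field) \<Rightarrow> (nat \<Rightarrow> 'a) \<Rightarrow> (nat \<Rightarrow> 'a)" where
  "vadd u v = (\<lambda>i. u i + v i)"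

definition lincomb :: "(nat \<Rightarrow> 'a::field) set \<Rightarrow> ((nat \<Rightarrow> 'a) \<Rightarrow> 'a) \<Rightarrow> (nat \<Rightarrow> 'a)" where
  "lincomb B a = (\<lambda>i. \<Sum>b\<in>B. a b * b i)"

definition lin_indep :: "(nat \<Rightarrow> 'a::field) set \<Rightarrow> bool" where
  "lin_indep B \<longleftrightarrow> finite B \<and> (\<forall>a. lincomb B a = vzero \<longrightarrow> (\<forall>b\<in>B. a b = 0))"

definition lin_span :: "(nat \<Rightarrow> 'a::field) set \<Rightarrow> (nat \<Rightarrow> 'a) set" where
  "lin_span B = {lincomb B a | a. True}"

definition is_subspace :: "nat \<Rightarrow> (nat \<Rightarrow> 'a::field) set \<Rightarrow> bool" where
  "is_subspace n W \<longleftrightarrow> W \<subseteq> fvec n \<and> vzero \<in> W \<and>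
     (\<forall>u\<in>W. \<forall>v\<in>W. vadd u v \<in> W) \<and> (\<forall>c. \<forall>v\<in>W. vscale c v \<in> W)"

definition subspace_dim :: "nat \<Rightarrow> (nat \<Rightarrow> 'a::field) set \<Rightarrow> nat \<Rightarrow> bool" where
  "subspace_dim n W d \<longleftrightarrow> is_subspace n W \<and>
     (\<exists>B. B \<subseteq> W \<and> lin_indep B \<and> card B = d \<and> lin_span B = W)"

text \<open>Property defining the vector-space Ramsey number: every red/blue colouring
  (True = red) of the 1-dimensional subspaces of \<open>F^n\<close> has a red s-dimensional
  subspace or a blue t-dimensional subspace.\<close>
definition ramsey_prop :: "'a::{field,finite} itself \<Rightarrow> nat \<Rightarrow> nat \<Rightarrow> nat \<Rightarrow> bool" where
  "ramsey_prop _ s t n \<longleftrightarrow>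
     (\<forall>col :: (nat \<Rightarrow> 'a) set \<Rightarrow> bool.
        (\<exists>W. subspace_dim n W s \<and> (\<forall>L. subspace_dim n L 1 \<and> L \<subseteq> W \<longrightarrow> col L)) \<or>
        (\<exists>W. subspace_dim n W t \<and> (\<forall>L. subspace_dim n L 1 \<and> L \<subseteq> W \<longrightarrow> \<not> col L)))"

definition vramsey :: "'a::{field,finite} itself \<Rightarrow> nat \<Rightarrow> nat \<Rightarrow> nat" where
  "vramsey F s t = (LEAST n. ramsey_prop F s t n)"

definition fp_gamma :: real where
  "fp_gamma = Inf ((\<lambda>x. (1 + x + x\<^sup>2) / x powr (2/3)) ` {0<..<1})"

definition C0 :: real where
  "C0 = 1 + 1 / (1 - log 3 fp_gamma)"

end

theory Submission
  imports Defs "HOL-Library.Function_Algebras"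
begin

text \<open>Let \<open>A\<close> be the set of nonzero vectors spanning a red line, and suppose that there is neither a red
plane nor a blue \<open>t\<close>-space. If \<open>A\<close> had density below \<open>q\<^sup>-\<^sup>t\<close>, a blue \<open>t\<close>-space could be built greedily.
For a dense \<open>A\<close>, one repeatedly chooses directions outside the span built so far and replaces \<open>A\<close> by
the set of base points of a fixed configuration in these directions.

For \<open>q = 3\<close> the configuration is \<open>x, x + d, x - d\<close>; each step raises the density to the power \<open>C0\<close>
(up to a constant factor), and after \<open>t\<close> steps \<open>A\<close> contains a coset of a \<open>t\<close>-space \<open>W\<close>. A red \<open>v \<in> W\<close>
would then give a red plane. For \<open>q = 2\<close> the configuration consists of six vectors summing to zero; it
lives in four dimensions, its pairwise sums cover all of \<open>F\<^sup>4\<close>, and the density is raised to the power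
\<open>6\<close>. Every element of the resulting space is a sum of two elements of \<open>A\<close>, which is enough.

The exponent \<open>C0\<close> comes from the slice rank bound \<open>3 \<gamma>\<^sup>d\<close> for tricolored sum-free sets in \<open>F\<^sup>d\<close>.
After passing to a subset of \<open>A\<close> in which no point lies in many more progressions than the average
one, pull it back along a random affine map from \<open>F\<^sup>d\<close>. If \<open>d\<close> is just so small that a surviving
progression expects to share a point with less than one other survivor, then a positive proportion
of the survivors is isolated, and these form a tricolored sum-free set.\<close>

section \<open>Subspaces of coordinate space\<close>

lemma vadd_eq: "vadd u v = u + v"
  by (auto simp: vadd_def)

lemma vzero_eq: "vzero = 0"
  by (auto simp: vzero_def)

lemma vscale_apply [simp]: "vscale c v i = c * v i"
  by (simp add: vscale_def)

lemma vscale_simps [simp]: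
  "vscale 0 v = 0" "vscale c 0 = 0" "vscale 1 v = v" "vscale (- 1) v = - v"
  by auto

lemma vscale_vscale [simp]: "vscale a (vscale b v) = vscale (a * b) v"
  by (auto simp: mult.assoc)

lemma vscale_add_right: "vscale c (u + v) = vscale c u + vscale c v"
  by (auto simp: algebra_simps)

lemma vscale_add_left: "vscale (a + b) v = vscale a v + vscale b v"
  by (auto simp: algebra_simps)

lemma is_subspace_iff:
  "is_subspace n W \<longleftrightarrow> W \<subseteq> fvec n \<and> 0 \<in> W \<and>
     (\<forall>u\<in>W. \<forall>v\<in>W. u + v \<in> W) \<and> (\<forall>c. \<forall>v\<in>W. vscale c v \<in> W)"
  by (simp add: is_subspace_def vadd_eq vzero_eq)

lemma fvec_closed [simp]:
  "0 \<in> fvec n" "u \<in> fvec n \<Longrightarrow> v \<in> fvec n \<Longrightarrow> u + v \<in> fvec n"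
  "u \<in> fvec n \<Longrightarrow> v \<in> fvec n \<Longrightarrow> u - v \<in> fvec n"
  "u \<in> fvec n \<Longrightarrow> - u \<in> fvec n" "u \<in> fvec n \<Longrightarrow> vscale c u \<in> fvec n"
  by (auto simp: fvec_def)

text \<open>Vectors are total functions vanishing from index \<open>n\<close> on, so the first
  \<open>n\<close> values determine them. This transfers finiteness and cardinality from function
  spaces.\<close>

lemma bij_betw_fvec_PiE:
  "bij_betw (\<lambda>v. restrict v {..<n}) (fvec n :: (nat \<Rightarrow> 'a::field) set) ({..<n} \<rightarrow>\<^sub>E UNIV)"
proof (rule bij_betw_byWitness[where f' = "\<lambda>f i. if i < n then f i else 0"])
  show "\<forall>v\<in>fvec n. (\<lambda>i. if i < n then restrict v {..<n} i else 0) = (v :: nat \<Rightarrow> 'a)"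
    by (intro ballI ext) (simp add: fvec_def)
  show "\<forall>f\<in>{..<n} \<rightarrow>\<^sub>E UNIV. restrict (\<lambda>i. if i < n then f i else (0 :: 'a)) {..<n} = f"
    by (intro ballI ext) (simp add: PiE_def extensional_def)
  show "(\<lambda>v. restrict v {..<n}) ` (fvec n :: (nat \<Rightarrow> 'a) set) \<subseteq> {..<n} \<rightarrow>\<^sub>E UNIV"
    by (intro image_subsetI restrict_PiE_iff[THEN iffD2]) simp
  show "(\<lambda>f i. if i < n then f i else (0 :: 'a)) ` ({..<n} \<rightarrow>\<^sub>E UNIV) \<subseteq> fvec n"
    by (intro image_subsetI) (simp add: fvec_def)
qed

lemma finite_fvec [simp]: "finite (fvec n :: (nat \<Rightarrow> 'a::{field,finite}) set)"
  using bij_betw_finite[OF bij_betw_fvec_PiE[of n, where ?'a = 'a]] by (simp add: finite_PiE)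

lemma card_fvec: "card (fvec n :: (nat \<Rightarrow> 'a::{field,finite}) set) = CARD('a) ^ n"
  using bij_betw_same_card[OF bij_betw_fvec_PiE[of n, where ?'a = 'a]] by (simp add: card_PiE)

lemma lincomb_insert:
  assumes "finite B" "v \<notin> B"
  shows "lincomb (insert v B) a = lincomb B a + vscale (a v) v"
  using assms by (auto simp: lincomb_def fun_eq_iff add.commute)

lemma lincomb_cong: "(\<And>b. b \<in> B \<Longrightarrow> a b = a' b) \<Longrightarrow> lincomb B a = lincomb B a'"
  by (auto simp: lincomb_def intro!: sum.cong)

lemma lincomb_mono:
  assumes "finite B" "B' \<subseteq> B"
  shows "lincomb B' a = lincomb B (\<lambda>b. if b \<in> B' then a b else 0)"
proof -
  have "(\<Sum>b\<in>B'. a b * b i) = (\<Sum>b\<in>B. (if b \<in> B' then a b else 0) * b i)" for i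
    using assms by (intro sum.mono_neutral_cong_left) auto
  thus ?thesis by (simp add: lincomb_def)
qed

lemma is_subspace_lin_span:
  assumes "B \<subseteq> fvec n"
  shows "is_subspace n (lin_span B)"
  unfolding is_subspace_iff
proof (intro conjI ballI allI)
  show "lin_span B \<subseteq> fvec n"
    using assms by (auto simp: lin_span_def lincomb_def fvec_def subset_iff intro!: sum.neutral)
  have "lincomb B (\<lambda>_. 0) = 0" by (auto simp: lincomb_def)
  thus "0 \<in> lin_span B" unfolding lin_span_def by (metis (mono_tags) mem_Collect_eq)
next
  fix u v assume "u \<in> lin_span B" "v \<in> lin_span B"
  then obtain a b where "u = lincomb B a" "v = lincomb B b" by (auto simp: lin_span_def)
  hence "u + v = lincomb B (\<lambda>x. a x + b x)"
    by (auto simp: lincomb_def sum.distrib algebra_simps)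
  thus "u + v \<in> lin_span B" by (auto simp: lin_span_def)
next
  fix c v assume "v \<in> lin_span B"
  then obtain a where "v = lincomb B a" by (auto simp: lin_span_def)
  hence "vscale c v = lincomb B (\<lambda>x. c * a x)"
    by (auto simp: lincomb_def sum_distrib_left algebra_simps)
  thus "vscale c v \<in> lin_span B" by (auto simp: lin_span_def)
qed

text \<open>Any \<open>t\<close> elements of a basis span such a subspace. The construction over two
  elements raises the dimension by four at a time and may overshoot \<open>t\<close>.\<close>

lemma subspace_dim_le:
  assumes "subspace_dim n W d" "t \<le> d"
  obtains W' where "W' \<subseteq> W" "subspace_dim n W' t"
proof -
  obtain B where B: "B \<subseteq> W" "lin_indep B" "card B = d" "lin_span B = W"
    using assms by (auto simp: subspace_dim_def)
  have fin: "finite B" using B by (simp add: lin_indep_def)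
  have "t \<le> card B" using assms(2) B(3) by simp
  then obtain B' where B': "B' \<subseteq> B" "card B' = t"
    by (rule obtain_subset_with_card_n)
  have finB': "finite B'" by (rule finite_subset[OF B'(1) fin])
  have mono: "lincomb B' a = lincomb B (\<lambda>b. if b \<in> B' then a b else 0)" for a
    by (rule lincomb_mono[OF fin B'(1)])
  have "lin_indep B'"
    unfolding lin_indep_def
  proof (intro conjI allI impI ballI)
    fix a b assume a: "lincomb B' a = vzero" "b \<in> B'"
    let ?a = "\<lambda>b. if b \<in> B' then a b else 0"
    have "lincomb B ?a = vzero" using a(1) by (simp only: mono)
    moreover have "b \<in> B" using a(2) B'(1) by blast
    ultimately have "?a b = 0" using B(2) unfolding lin_indep_def by blast
    thus "a b = 0" using a(2) by simp
  qed (rule finB')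
  moreover have "B' \<subseteq> lin_span B'"
  proof
    fix b assume b: "b \<in> B'"
    have "b = lincomb B' (\<lambda>x. if x = b then 1 else 0)"
    proof
      fix i
      have "(\<Sum>x\<in>B'. (if x = b then 1 else 0) * x i) = (\<Sum>x\<in>B'. if x = b then x i else 0)"
        by (intro sum.cong) auto
      thus "b i = lincomb B' (\<lambda>x. if x = b then 1 else 0) i"
        using b finB' by (simp add: lincomb_def)
    qed
    thus "b \<in> lin_span B'" unfolding lin_span_def by blast
  qed
  moreover have "is_subspace n (lin_span B')"
    using assms(1) B(1) B'(1)
    by (intro is_subspace_lin_span) (auto simp: subspace_dim_def is_subspace_def)
  moreover have "lin_span B' \<subseteq> W"
  proof
    fix x assume "x \<in> lin_span B'"
    then obtain a where "x = lincomb B' a" unfolding lin_span_def by blast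
    thus "x \<in> W" unfolding B(4)[symmetric] lin_span_def mono by blast
  qed
  ultimately show thesis
    using B'(2) by (intro that[of "lin_span B'"]) (simp_all only: subspace_dim_def, blast)
qed

section \<open>Adjoining a vector to a subspace\<close>

definition extend :: "(nat \<Rightarrow> 'a::field) \<Rightarrow> (nat \<Rightarrow> 'a) set \<Rightarrow> (nat \<Rightarrow> 'a) set" where
  "extend v W = (\<lambda>(w, c). w + vscale c v) ` (W \<times> UNIV)"

lemma mem_extend: "x \<in> extend v W \<longleftrightarrow> (\<exists>w\<in>W. \<exists>c. x = w + vscale c v)"
  by (auto simp: extend_def)

lemma mem_extendE:
  assumes "x \<in> extend v W"
  obtains w c where "w \<in> W" "x = w + vscale c v"
  using assms unfolding mem_extend by auto

lemma card_extend:
  assumes "finite (W :: (nat \<Rightarrow> 'a::{field,finite}) set)"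
  shows "card (extend v W) \<le> card W * CARD('a)"
  unfolding extend_def using card_image_le[of "W \<times> (UNIV :: 'a set)"] assms
  by (simp add: card_cartesian_product)

lemma is_subspace_extend:
  assumes "is_subspace n W" "v \<in> fvec n"
  shows "is_subspace n (extend v W)"
proof -
  have W: "W \<subseteq> fvec n" "0 \<in> W" "\<And>u w. u \<in> W \<Longrightarrow> w \<in> W \<Longrightarrow> u + w \<in> W"
    "\<And>c w. w \<in> W \<Longrightarrow> vscale c w \<in> W"
    using assms(1) by (auto simp only: is_subspace_iff)
  have I: "w + vscale c v \<in> extend v W" if "w \<in> W" for w c
    using that unfolding mem_extend by blast
  have "extend v W \<subseteq> fvec n"
  proof
    fix x assume "x \<in> extend v W"
    then obtain w c where "w \<in> W" "x = w + vscale c v" unfolding mem_extend by blast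
    thus "x \<in> fvec n" using W(1) assms(2) by (simp only: fvec_closed subsetD)
  qed
  moreover have "0 \<in> extend v W" using I[OF W(2), of 0] by simp
  moreover have "x + y \<in> extend v W" if xy: "x \<in> extend v W" "y \<in> extend v W" for x y
  proof -
    obtain w c w' c' where w: "w \<in> W" "w' \<in> W" "x = w + vscale c v" "y = w' + vscale c' v"
      using xy unfolding mem_extend by blast
    have "x + y = (w + w') + vscale (c + c') v"
      unfolding w(3,4) vscale_add_left by (simp only: add_ac)
    thus ?thesis using I[OF W(3)[OF w(1,2)]] by simp
  qed
  moreover have "vscale a x \<in> extend v W" if x: "x \<in> extend v W" for a x
  proof -
    obtain w c where w: "w \<in> W" "x = w + vscale c v" using x unfolding mem_extend by blast
    have "vscale a x = vscale a w + vscale (a * c) v"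
      unfolding w(2) vscale_add_right by simp
    thus ?thesis using I[OF W(4)[OF w(1)]] by simp
  qed
  ultimately show ?thesis unfolding is_subspace_iff by blast
qed

lemma subspace_dim_zero: "subspace_dim n {0} 0"
proof -
  have "lincomb {} a = 0" for a :: "(nat \<Rightarrow> 'a) \<Rightarrow> 'a" by (auto simp: lincomb_def)
  thus ?thesis
    by (auto simp: subspace_dim_def is_subspace_iff lin_indep_def lin_span_def intro!: exI[of _ "{}"])
qed

lemma subspace_dim_extend:
  assumes W: "subspace_dim n W d" and v: "v \<in> fvec n" "v \<notin> W"
  shows "subspace_dim n (extend v W) (Suc d)"
proof -
  obtain B where B: "B \<subseteq> W" "lin_indep B" "card B = d" "lin_span B = W"
    using W by (auto simp: subspace_dim_def)
  have sub: "is_subspace n W" using W by (simp add: subspace_dim_def)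
  have fin: "finite B" and vB: "v \<notin> B" using B v by (auto simp: lin_indep_def)
  have inW: "lincomb B a \<in> W" for a using B(4) by (auto simp: lin_span_def)
  have "lin_indep (insert v B)"
    unfolding lin_indep_def
  proof (intro conjI allI impI ballI)
    show "finite (insert v B)" using fin by simp
    fix a b assume a: "lincomb (insert v B) a = vzero" "b \<in> insert v B"
    hence eq: "lincomb B a + vscale (a v) v = 0"
      using lincomb_insert[OF fin vB] by (simp add: vzero_eq)
    \<comment> \<open>A nonzero coefficient at \<open>v\<close> would express \<open>v\<close>
      through \<open>B\<close> and so place it in \<open>W\<close>.\<close>
    have av: "a v = 0"
    proof (rule ccontr)
      assume nz: "a v \<noteq> 0"
      have "v = vscale (- inverse (a v)) (lincomb B a)"
      proof
        fix i
        have "lincomb B a i + a v * v i = 0" using fun_cong[OF eq, of i] by simp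
        thus "v i = vscale (- inverse (a v)) (lincomb B a) i"
          using nz by (simp add: field_simps eq_neg_iff_add_eq_0)
      qed
      thus False using inW[of a] sub v(2) unfolding is_subspace_iff by metis
    qed
    hence "lincomb B a = vzero" using eq by (simp add: vzero_eq)
    thus "a b = 0" using B(2) a(2) av unfolding lin_indep_def by blast
  qed
  moreover have "insert v B \<subseteq> extend v W"
  proof -
    have "\<exists>w\<in>W. \<exists>c. b = w + vscale c v" if "b \<in> B" for b
      using B(1) that by (intro bexI[of _ b] exI[of _ 0]) auto
    moreover have "\<exists>w\<in>W. \<exists>c. v = w + vscale c v"
      using sub by (intro bexI[of _ 0] exI[of _ 1]) (auto simp: is_subspace_iff)
    ultimately show ?thesis by (auto simp: mem_extend)
  qed
  moreover have "card (insert v B) = Suc d" using B fin vB by simp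
  moreover have "lin_span (insert v B) = extend v W"
  proof (intro equalityI subsetI)
    fix x assume "x \<in> lin_span (insert v B)"
    then obtain a where "x = lincomb B a + vscale (a v) v"
      by (auto simp: lin_span_def lincomb_insert[OF fin vB])
    thus "x \<in> extend v W" using inW by (auto simp: mem_extend)
  next
    fix x assume "x \<in> extend v W"
    then obtain a c where x: "x = lincomb B a + vscale c v"
      using B(4) by (auto simp: mem_extend lin_span_def)
    have "lincomb (insert v B) (a(v := c)) = lincomb B (a(v := c)) + vscale c v"
      by (simp add: lincomb_insert[OF fin vB])
    also have "lincomb B (a(v := c)) = lincomb B a"
      using vB by (intro lincomb_cong) auto
    finally have "x = lincomb (insert v B) (a(v := c))" by (simp only: x)
    thus "x \<in> lin_span (insert v B)" unfolding lin_span_def by blast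
  qed
  ultimately show ?thesis
    using is_subspace_extend[OF sub v(1)] unfolding subspace_dim_def by blast
qed

section \<open>Lines, red vectors and the greedy blue subspace\<close>

definition line :: "(nat \<Rightarrow> 'a::field) \<Rightarrow> (nat \<Rightarrow> 'a) set" where
  "line v = range (\<lambda>c. vscale c v)"

lemma line_vscale:
  assumes "c \<noteq> 0"
  shows "line (vscale c v) = line v"
proof -
  have "vscale a v \<in> line (vscale c v)" for a
  proof -
    have "vscale a v = vscale (a / c) (vscale c v)" using assms by simp
    thus ?thesis unfolding line_def by (rule range_eqI)
  qed
  moreover have "vscale a (vscale c v) \<in> line v" for a
    unfolding line_def vscale_vscale by (rule rangeI)
  ultimately show ?thesis unfolding line_def by blast
qed

lemma subspace_dim_1_line:
  assumes "subspace_dim n L 1"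
  obtains v where "v \<in> L" "v \<noteq> 0" "L = line v"
proof -
  obtain B where B: "B \<subseteq> L" "lin_indep B" "card B = 1" "lin_span B = L"
    using assms by (auto simp: subspace_dim_def)
  then obtain v where v: "B = {v}" by (auto simp: card_1_singleton_iff)
  have lc: "lincomb {v} a = vscale (a v) v" for a by (auto simp: lincomb_def)
  have "v \<noteq> 0"
  proof
    assume "v = 0"
    hence "lincomb B (\<lambda>_. 1) = vzero" using v by (auto simp: lincomb_def vzero_eq)
    hence "(1::'a) = 0" using B(2) v unfolding lin_indep_def by blast
    thus False by simp
  qed
  moreover have "L = line v"
  proof -
    have "vscale c v \<in> lin_span {v}" for c unfolding lin_span_def lc by force
    thus ?thesis using B(4) v by (auto simp: lin_span_def lc line_def)
  qed
  ultimately show thesis using B v that by auto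
qed

text \<open>The colouring of lines becomes a set of vectors closed under nonzero scalars. Zero spans
  no line and is excluded, which later keeps base points off the line of a red direction.\<close>

definition red_vectors :: "((nat \<Rightarrow> 'a::field) set \<Rightarrow> bool) \<Rightarrow> nat \<Rightarrow> (nat \<Rightarrow> 'a) set" where
  "red_vectors col n = {v \<in> fvec n - {0}. col (line v)}"

lemma blueI:
  assumes "subspace_dim n W d" "W \<inter> red_vectors col n = {}" "subspace_dim n L 1" "L \<subseteq> W"
  shows "\<not> col L"
proof -
  obtain v where v: "v \<in> L" "v \<noteq> 0" "L = line v" using assms subspace_dim_1_line by blast
  hence "v \<in> fvec n" using assms by (auto simp: subspace_dim_def is_subspace_def)
  thus ?thesis using v assms by (auto simp: red_vectors_def)
qed

lemma red_vectors_vscale: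
  assumes "v \<in> red_vectors col n" "c \<noteq> 0"
  shows "vscale c v \<in> red_vectors col n"
proof -
  have "vscale c v \<noteq> 0"
  proof
    assume "vscale c v = 0"
    hence "vscale (inverse c) (vscale c v) = 0" by (simp only: vscale_simps)
    hence "v = 0" unfolding vscale_vscale using assms(2) by simp
    thus False using assms(1) by (simp add: red_vectors_def)
  qed
  moreover have "v \<in> fvec n" "col (line v)" using assms(1) by (auto simp: red_vectors_def)
  ultimately show ?thesis using assms(2) by (simp add: red_vectors_def line_vscale)
qed

text \<open>The plane spanned by \<open>x\<close> and \<open>y\<close> contains a blue line. A
  generator \<open>a x + b y\<close> of it has \<open>b \<noteq> 0\<close>, as nonzero multiples of
  the red \<open>x\<close> are red; dividing by \<open>b\<close> gives the claimed vector.\<close>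

lemma no_red_plane:
  fixes x y :: "nat \<Rightarrow> 'a::{field,finite}"
  assumes no: "\<And>W. subspace_dim n W 2 \<Longrightarrow> \<exists>L. subspace_dim n L 1 \<and> L \<subseteq> W \<and> \<not> col L"
    and x: "x \<in> red_vectors col n" and y: "y \<in> fvec n" "y \<notin> line x"
  obtains c where "y + vscale c x \<notin> red_vectors col n"
proof -
  have x': "x \<in> fvec n" "x \<noteq> 0" using x by (auto simp: red_vectors_def)
  have dim1: "subspace_dim n (extend x {0}) (Suc 0)"
    using subspace_dim_extend[OF subspace_dim_zero x'(1)] x'(2) by blast
  have "y \<notin> extend x {0}" using y(2) unfolding mem_extend line_def by auto
  hence "subspace_dim n (extend y (extend x {0})) 2"
    using subspace_dim_extend[OF dim1 y(1)] by (simp add: numeral_2_eq_2)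
  from no[OF this] obtain L where L: "subspace_dim n L 1" "L \<subseteq> extend y (extend x {0})" "\<not> col L"
    by blast
  obtain v where v: "v \<in> L" "v \<noteq> 0" "L = line v" by (rule subspace_dim_1_line[OF L(1)])
  have vn: "v \<notin> red_vectors col n" using v(3) L(3) by (simp add: red_vectors_def)
  have "v \<in> extend y (extend x {0})" using v(1) L(2) by blast
  then obtain w b where wb: "w \<in> extend x {0}" "v = w + vscale b y"
    by (rule mem_extendE)
  obtain a where "w = 0 + vscale a x" using wb(1) by (rule mem_extendE) simp
  hence ab: "v = vscale a x + vscale b y" using wb(2) by (simp only: add_0_left)
  have "b \<noteq> 0"
  proof
    assume "b = 0"
    hence va: "v = vscale a x" using ab by (simp only: vscale_simps add_0_right)
    hence "a \<noteq> 0" using v(2) by (metis vscale_simps(1))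
    thus False using red_vectors_vscale[OF x \<open>a \<noteq> 0\<close>] vn va by simp
  qed
  have "vscale b (y + vscale (a / b) x) = v"
    unfolding ab vscale_add_right vscale_vscale using \<open>b \<noteq> 0\<close> by (simp add: add.commute)
  hence "y + vscale (a / b) x \<notin> red_vectors col n"
    using vn red_vectors_vscale[of "y + vscale (a / b) x" col n b] \<open>b \<noteq> 0\<close> by auto
  thus thesis using that by blast
qed

text \<open>A vector \<open>v\<close> can be adjoined to \<open>W\<close> unless it is the
  difference of a red or zero vector and an element of \<open>W\<close>. Before dimension
  \<open>t\<close> is reached, these differences are too few to fill the space.\<close>

lemma greedy_blue:
  fixes col :: "(nat \<Rightarrow> 'a::{field,finite}) set \<Rightarrow> bool"
  assumes small: "CARD('a) ^ (t - 1) * (card (red_vectors col n) + 1) < CARD('a) ^ n"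
  shows "k \<le> t \<Longrightarrow> \<exists>W. subspace_dim n W k \<and> card W \<le> CARD('a) ^ k \<and> W \<inter> red_vectors col n = {}"
proof (induction k)
  case 0
  show ?case using subspace_dim_zero by (intro exI[of _ "{0}"]) (auto simp: red_vectors_def)
next
  case (Suc k)
  then obtain W where W: "subspace_dim n W k" "card W \<le> CARD('a) ^ k" "W \<inter> red_vectors col n = {}"
    by auto
  \<comment> \<open>Zero counts as forbidden too, so that avoiding all differences also gives
    \<open>v \<notin> W\<close>.\<close>
  let ?A = "insert 0 (red_vectors col n)"
  have subW: "is_subspace n W" using W by (simp add: subspace_dim_def)
  hence finW: "finite W" using finite_subset[OF _ finite_fvec] by (auto simp: is_subspace_def)
  have finA: "finite ?A" using finite_subset[OF _ finite_fvec, of _ n] by (auto simp: red_vectors_def)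
  have "card ((\<lambda>(a, w). a - w) ` (?A \<times> W)) \<le> card ?A * card W"
    using card_image_le[of "?A \<times> W"] finA finW by (simp add: card_cartesian_product)
  also have "\<dots> \<le> (card (red_vectors col n) + 1) * CARD('a) ^ (t - 1)"
  proof (intro mult_mono)
    show "card ?A \<le> card (red_vectors col n) + 1" by (simp add: card_insert_le_m1 card_insert_if finA[simplified])
    have "CARD('a) ^ k \<le> CARD('a) ^ (t - 1)" using Suc.prems by (intro power_increasing) auto
    thus "card W \<le> CARD('a) ^ (t - 1)" using W by linarith
  qed auto
  also have "\<dots> < card (fvec n :: (nat \<Rightarrow> 'a) set)" using small by (simp add: card_fvec mult.commute)
  finally obtain v where v: "v \<in> fvec n" "v \<notin> (\<lambda>(a, w). a - w) ` (?A \<times> W)"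
    by (metis card_mono finA finW finite_SigmaI finite_imageI linorder_not_le subsetI)
  have nz: "v + w \<notin> ?A" if "w \<in> W" for w
  proof
    assume "v + w \<in> ?A"
    hence "v \<in> (\<lambda>(a, w). a - w) ` (?A \<times> W)" using that by (intro image_eqI[of _ _ "(v + w, w)"]) auto
    thus False using v by simp
  qed
  have "v \<notin> W"
  proof
    assume "v \<in> W"
    hence "- v \<in> W" using subW unfolding is_subspace_iff by (metis vscale_simps(4))
    thus False using nz[of "- v"] by simp
  qed
  moreover have "extend v W \<inter> red_vectors col n = {}"
  proof (safe, goal_cases)
    case (1 x)
    then obtain w c where wc: "w \<in> W" "x = w + vscale c v" by (auto simp: mem_extend)
    \<comment> \<open>Dividing by the coefficient of \<open>v\<close> turns a red vector of the
      extension into a red vector of the form \<open>v + w\<close>.\<close>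
    have c: "c \<noteq> 0" using 1 wc W(3) by auto
    hence "v + vscale (inverse c) w = vscale (inverse c) x"
      using wc by (auto simp: fun_eq_iff field_simps)
    moreover have "vscale (inverse c) x \<in> red_vectors col n" using 1 c by (intro red_vectors_vscale) auto
    moreover have "vscale (inverse c) w \<in> W" using subW wc unfolding is_subspace_iff by blast
    ultimately show ?case using nz by (metis insertCI)
  qed
  moreover have "card (extend v W) \<le> CARD('a) ^ Suc k"
    using order_trans[OF card_extend[OF finW, of v] mult_right_mono[OF W(2), of "CARD('a)"]]
    by (simp add: mult.commute)
  ultimately show ?case using subspace_dim_extend[OF W(1) v(1)] by blast
qed

section \<open>Tricolored sum-free sets\<close>

lemma CARD_field_ge_2: "2 \<le> CARD('a::{field,finite})"
  using card_mono[of UNIV "{0, 1 :: 'a}"] by simp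

text \<open>Counting replaces rank: there are fewer value vectors on \<open>M\<close> than
  coefficient vectors on \<open>J\<close>, so two of the latter have equal values, and their
  difference solves the homogeneous system.\<close>

lemma pigeonhole_kernel:
  fixes \<phi> :: "'m \<Rightarrow> 'j \<Rightarrow> 'a::{field,finite}"
  assumes fin: "finite J" "finite M" and less: "card M < card J"
  obtains g where "\<And>j. j \<notin> J \<Longrightarrow> g j = 0" "\<exists>j\<in>J. g j \<noteq> 0"
    "\<And>m. m \<in> M \<Longrightarrow> (\<Sum>j\<in>J. g j * \<phi> m j) = 0"
proof -
  define F where "F = (\<lambda>g. restrict (\<lambda>m. \<Sum>j\<in>J. g j * \<phi> m j) M)"
  have "F ` (J \<rightarrow>\<^sub>E UNIV) \<subseteq> M \<rightarrow>\<^sub>E UNIV"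
    unfolding F_def by (intro image_subsetI restrict_PiE_iff[THEN iffD2]) simp
  hence "card (F ` (J \<rightarrow>\<^sub>E UNIV)) \<le> card (M \<rightarrow>\<^sub>E (UNIV :: 'a set))"
    using fin by (intro card_mono finite_PiE) auto
  also have "\<dots> < card (J \<rightarrow>\<^sub>E (UNIV :: 'a set))"
    using CARD_field_ge_2[where 'a = 'a] less fin
    by (simp add: card_PiE)
  finally have "\<not> inj_on F (J \<rightarrow>\<^sub>E UNIV)"
    using pigeonhole by blast
  then obtain f g where fg: "f \<in> J \<rightarrow>\<^sub>E UNIV" "g \<in> J \<rightarrow>\<^sub>E UNIV" "F f = F g" "f \<noteq> g"
    unfolding inj_on_def by blast
  show thesis
  proof (rule that[of "\<lambda>j. if j \<in> J then f j - g j else 0"])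
    show "\<exists>j\<in>J. (if j \<in> J then f j - g j else 0) \<noteq> 0"
      using fg PiE_ext[OF fg(1,2)] by fastforce
  next
    fix m assume "m \<in> M"
    hence "(\<Sum>j\<in>J. f j * \<phi> m j) = (\<Sum>j\<in>J. g j * \<phi> m j)"
      using fun_cong[OF fg(3), of m] by (simp add: F_def)
    thus "(\<Sum>j\<in>J. (if j \<in> J then f j - g j else 0) * \<phi> m j) = 0"
      by (simp add: left_diff_distrib sum_subtractf)
  qed auto
qed

text \<open>Contracting the first index with a vector \<open>h\<close> orthogonal to all
  \<open>p m\<close> kills the first family and leaves the diagonal matrix with entries
  \<open>h\<close>, of rank at most \<open>2 * card M\<close>. If
  \<open>card I > 3 * card M\<close>, some such \<open>h\<close> has support larger than this
  rank.\<close>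

lemma diagonal_tensor_bound:
  fixes p q r :: "'m \<Rightarrow> 'i \<Rightarrow> 'a::{field,finite}" and P Q R :: "'m \<Rightarrow> 'i \<Rightarrow> 'i \<Rightarrow> 'a"
  assumes fin: "finite I" "finite M"
    and tensor: "\<And>i j k. i \<in> I \<Longrightarrow> j \<in> I \<Longrightarrow> k \<in> I \<Longrightarrow> (if i = j \<and> j = k then 1 else 0) =
      (\<Sum>m\<in>M. p m i * P m j k) + (\<Sum>m\<in>M. q m j * Q m i k) + (\<Sum>m\<in>M. r m k * R m i j)"
  shows "card I \<le> 3 * card M"
proof (rule ccontr)
  assume big: "\<not> ?thesis"
  define H where "H h \<longleftrightarrow> (\<forall>m\<in>M. (\<Sum>i\<in>I. h i * p m i) = 0)" for h :: "'i \<Rightarrow> 'a"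
  define supp where "supp h = {i\<in>I. h i \<noteq> 0}" for h :: "'i \<Rightarrow> 'a"
  have supp_le: "card (supp h) \<le> card I" for h
    unfolding supp_def using fin by (intro card_mono) auto
  have "H (\<lambda>_. 0)" by (simp add: H_def)
  moreover have "\<forall>h. H h \<longrightarrow> card (supp h) < Suc (card I)" using supp_le by (simp add: less_Suc_eq_le)
  ultimately obtain h where h: "H h" "\<And>h'. H h' \<Longrightarrow> card (supp h') \<le> card (supp h)"
    using ex_has_greatest_nat[of H "\<lambda>_. 0" "\<lambda>h. card (supp h)" "Suc (card I)"] by blast
  \<comment> \<open>Otherwise \<open>h\<close> could be changed off its support to a vector of larger support.\<close>
  have "card (I - supp h) \<le> card M"
  proof (rule ccontr)
    assume "\<not> ?thesis"
    hence "card M < card (I - supp h)" by simp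
    then obtain g where g: "\<And>j. j \<notin> I - supp h \<Longrightarrow> g j = 0" "\<exists>j\<in>I - supp h. g j \<noteq> 0"
        "\<And>m. m \<in> M \<Longrightarrow> (\<Sum>j\<in>I - supp h. g j * p m j) = 0"
      using pigeonhole_kernel[of "I - supp h" M p] fin by blast
    have "H (\<lambda>i. h i + g i)"
      unfolding H_def
    proof
      fix m assume m: "m \<in> M"
      have "(\<Sum>i\<in>I. g i * p m i) = (\<Sum>i\<in>I - supp h. g i * p m i)"
        using fin g(1) by (intro sum.mono_neutral_right) auto
      thus "(\<Sum>i\<in>I. (h i + g i) * p m i) = 0"
        using g(3)[OF m] h(1) m by (simp add: H_def distrib_right sum.distrib)
    qed
    moreover have "supp h \<subset> supp (\<lambda>i. h i + g i)"
    proof (rule psubsetI)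
      show "supp h \<subseteq> supp (\<lambda>i. h i + g i)" using g(1) by (auto simp: supp_def)
      obtain j where j: "j \<in> I - supp h" "g j \<noteq> 0" using g(2) by blast
      hence "j \<in> supp (\<lambda>i. h i + g i)" "j \<notin> supp h" by (auto simp: supp_def)
      thus "supp h \<noteq> supp (\<lambda>i. h i + g i)" by blast
    qed
    hence "card (supp h) < card (supp (\<lambda>i. h i + g i))"
      using fin by (intro psubset_card_mono) (auto simp: supp_def)
    ultimately show False using h(2) by (meson leD)
  qed
  moreover have "card (I - supp h) = card I - card (supp h)"
    using fin by (intro card_Diff_subset) (auto simp: supp_def)
  \<comment> \<open>The disjoint sum indexes the \<open>2 * card M\<close> linear conditions on
    \<open>\<psi>\<close>: orthogonality to the \<open>q m\<close> and to the contractions of the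
    \<open>R m\<close> with \<open>h\<close>.\<close>
  ultimately have "card (M <+> M) < card (supp h)" using big fin by (simp add: card_Plus)
  moreover have fin': "finite (supp h)" "finite (M <+> M)" using fin by (auto simp: supp_def)
  ultimately have less: "card (M <+> M) < card (supp h)" by blast
  obtain \<psi> where "\<And>j. j \<notin> supp h \<Longrightarrow> \<psi> j = 0" and \<psi>: "\<exists>j\<in>supp h. \<psi> j \<noteq> 0"
    "\<And>m. m \<in> M <+> M \<Longrightarrow>
      (\<Sum>j\<in>supp h. \<psi> j * case_sum (\<lambda>m. q m j) (\<lambda>m. \<Sum>i\<in>I. h i * R m i j) m) = 0"
    by (rule pigeonhole_kernel[OF fin' less, where
          ?\<phi> = "\<lambda>m j. case_sum (\<lambda>m. q m j) (\<lambda>m. \<Sum>i\<in>I. h i * R m i j) m"], rule that)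
  have \<psi>q: "(\<Sum>j\<in>supp h. \<psi> j * q m j) = 0" if "m \<in> M" for m
    using \<psi>(2)[of "Inl m"] that by auto
  have \<psi>R: "(\<Sum>j\<in>supp h. \<psi> j * (\<Sum>i\<in>I. h i * R m i j)) = 0" if "m \<in> M" for m
    using \<psi>(2)[of "Inr m"] that by auto
  obtain k where k: "k \<in> supp h" "\<psi> k \<noteq> 0" using \<psi>(1) by blast
  have kI: "k \<in> I" "h k \<noteq> 0" using k by (auto simp: supp_def)
  have finS: "finite (supp h)" "supp h \<subseteq> I" using fin by (auto simp: supp_def)
  \<comment> \<open>The tensor contracted with \<open>h\<close> and \<open>\<psi>\<close> is
    evaluated at \<open>k\<close> in two ways: the diagonal side is nonzero, while each of the three
    families contributes zero.\<close>
  have "\<psi> k * h k = (\<Sum>j\<in>supp h. \<psi> j * (\<Sum>i\<in>I. h i * (if i = j \<and> j = k then 1 else 0)))"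
  proof -
    have "(\<Sum>i\<in>I. h i * (if i = j \<and> j = k then 1 else 0)) = (if j = k then h k else 0)" for j
      using fin kI by (cases "j = k") (simp_all add: if_distrib[of "\<lambda>x. _ * x"] cong: if_cong)
    thus ?thesis using finS k(1) by (simp add: if_distrib[of "\<lambda>x. _ * x"] cong: if_cong)
  qed
  also have "\<dots> = (\<Sum>j\<in>supp h. \<psi> j * (\<Sum>i\<in>I. h i * ((\<Sum>m\<in>M. p m i * P m j k) +
      (\<Sum>m\<in>M. q m j * Q m i k) + (\<Sum>m\<in>M. r m k * R m i j))))"
    by (intro sum.cong refl arg_cong2[where f = "(*)"] tensor) (use finS kI in auto)
  also have "\<dots> = (\<Sum>j\<in>supp h. \<psi> j * (\<Sum>i\<in>I. h i * (\<Sum>m\<in>M. p m i * P m j k)))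
      + (\<Sum>j\<in>supp h. \<psi> j * (\<Sum>i\<in>I. h i * (\<Sum>m\<in>M. q m j * Q m i k)))
      + (\<Sum>j\<in>supp h. \<psi> j * (\<Sum>i\<in>I. h i * (\<Sum>m\<in>M. r m k * R m i j)))"
    by (simp add: distrib_left sum.distrib)
  also have "(\<Sum>j\<in>supp h. \<psi> j * (\<Sum>i\<in>I. h i * (\<Sum>m\<in>M. p m i * P m j k))) = 0"
  proof (intro sum.neutral ballI)
    fix j
    have "(\<Sum>i\<in>I. h i * (\<Sum>m\<in>M. p m i * P m j k)) = (\<Sum>i\<in>I. \<Sum>m\<in>M. h i * p m i * P m j k)"
      by (simp add: sum_distrib_left mult.assoc)
    also have "\<dots> = (\<Sum>m\<in>M. \<Sum>i\<in>I. h i * p m i * P m j k)" by (rule sum.swap)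
    also have "\<dots> = (\<Sum>m\<in>M. (\<Sum>i\<in>I. h i * p m i) * P m j k)" by (simp add: sum_distrib_right)
    also have "\<dots> = 0" using h(1) by (simp add: H_def)
    finally show "\<psi> j * (\<Sum>i\<in>I. h i * (\<Sum>m\<in>M. p m i * P m j k)) = 0" by simp
  qed
  also have "(\<Sum>j\<in>supp h. \<psi> j * (\<Sum>i\<in>I. h i * (\<Sum>m\<in>M. q m j * Q m i k))) = 0"
  proof -
    have "(\<Sum>j\<in>supp h. \<psi> j * (\<Sum>i\<in>I. h i * (\<Sum>m\<in>M. q m j * Q m i k)))
      = (\<Sum>j\<in>supp h. \<Sum>i\<in>I. \<Sum>m\<in>M. \<psi> j * q m j * (h i * Q m i k))"
      by (simp add: sum_distrib_left mult_ac)
    also have "\<dots> = (\<Sum>i\<in>I. \<Sum>j\<in>supp h. \<Sum>m\<in>M. \<psi> j * q m j * (h i * Q m i k))"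
      by (rule sum.swap)
    also have "\<dots> = (\<Sum>i\<in>I. \<Sum>m\<in>M. \<Sum>j\<in>supp h. \<psi> j * q m j * (h i * Q m i k))"
      by (intro sum.cong refl sum.swap)
    also have "\<dots> = (\<Sum>i\<in>I. \<Sum>m\<in>M. (\<Sum>j\<in>supp h. \<psi> j * q m j) * (h i * Q m i k))"
      by (simp add: sum_distrib_right)
    also have "\<dots> = 0" by (simp add: \<psi>q)
    finally show ?thesis .
  qed
  also have "(\<Sum>j\<in>supp h. \<psi> j * (\<Sum>i\<in>I. h i * (\<Sum>m\<in>M. r m k * R m i j))) = 0"
  proof -
    have "(\<Sum>i\<in>I. h i * (\<Sum>m\<in>M. r m k * R m i j)) = (\<Sum>m\<in>M. r m k * (\<Sum>i\<in>I. h i * R m i j))" for j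
      unfolding sum_distrib_left by (subst sum.swap) (simp add: mult_ac)
    hence "(\<Sum>j\<in>supp h. \<psi> j * (\<Sum>i\<in>I. h i * (\<Sum>m\<in>M. r m k * R m i j)))
      = (\<Sum>j\<in>supp h. \<Sum>m\<in>M. r m k * (\<psi> j * (\<Sum>i\<in>I. h i * R m i j)))"
      by (simp add: sum_distrib_left[of "\<psi> _" _ M] mult_ac del: sum_distrib_left)
    also have "\<dots> = (\<Sum>m\<in>M. \<Sum>j\<in>supp h. r m k * (\<psi> j * (\<Sum>i\<in>I. h i * R m i j)))"
      by (rule sum.swap)
    also have "\<dots> = (\<Sum>m\<in>M. r m k * (\<Sum>j\<in>supp h. \<psi> j * (\<Sum>i\<in>I. h i * R m i j)))"
      by (intro sum.cong refl sum_distrib_left[symmetric])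
    also have "\<dots> = 0" by (simp add: \<psi>R)
    finally show ?thesis .
  qed
  finally show False using k kI by simp
qed

section \<open>The polynomial method over the field with three elements\<close>

lemma CARD_3_UNIV:
  assumes "CARD('a::{field,finite}) = 3"
  shows "(UNIV :: 'a set) = {0, 1, -1}" and "(1::'a) + 1 = -1"
proof -
  obtain x :: 'a where x: "x \<notin> {0, 1}"
    using card_mono[of "{0, 1 :: 'a}" UNIV] assms by (auto simp: subset_iff)
  have U: "UNIV = {0, 1, x}"
  proof (rule card_subset_eq[symmetric])
    show "card {0, 1, x} = CARD('a)" using x assms by auto
  qed auto
  \<comment> \<open>Since \<open>x + 1\<close> is neither \<open>1\<close> nor \<open>x\<close>, it
    is \<open>0\<close>.\<close>
  have "x + 1 \<in> {0, 1, x}" using U by blast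
  hence x1: "x = -1" using x by (auto simp: eq_neg_iff_add_eq_0)
  thus "(UNIV :: 'a set) = {0, 1, -1}" using U by simp
  have ne: "(1::'a) \<noteq> -1" using x x1 by auto
  have "(1::'a) + 1 \<in> {0, 1, -1}" using U x1 by blast
  moreover have "(1::'a) + 1 \<noteq> 0" using ne by (simp add: eq_neg_iff_add_eq_0)
  moreover have "(1::'a) + 1 \<noteq> 1" by (simp only: add_cancel_left_left one_neq_zero not_False_eq_True)
  ultimately show "(1::'a) + 1 = -1" by blast
qed

text \<open>Exponents of monomials in \<open>d\<close> variables with degree at most 2 in each and
  total degree at most \<open>2 * d / 3\<close>, a third of the degree bound for the indicator
  polynomial below.\<close>

definition low_exponents :: "nat \<Rightarrow> (nat \<Rightarrow> nat) set" where
  "low_exponents d = {a \<in> {..<d} \<rightarrow>\<^sub>E {0, 1, 2}. 3 * (\<Sum>l<d. a l) \<le> 2 * d}"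

lemma finite_low_exponents [simp]: "finite (low_exponents d)"
  unfolding low_exponents_def by (intro finite_subset[OF _ finite_PiE[of "{..<d}" "\<lambda>_. {0, 1, 2 :: nat}"]]) auto

text \<open>The monomials of \<open>1 - (x + y + z)\<^sup>2\<close>, which over three elements is
  the indicator of \<open>x + y + z = 0\<close>.\<close>

definition sq_exps :: "(nat \<times> nat \<times> nat) set" where
  "sq_exps = {(0,0,0), (2,0,0), (0,2,0), (0,0,2), (1,1,0), (1,0,1), (0,1,1)}"

definition sq_coef :: "nat \<times> nat \<times> nat \<Rightarrow> 'a::field" where
  "sq_coef e = (if e = (0,0,0) then 1 else if e \<in> {(2,0,0), (0,2,0), (0,0,2)} then - 1 else - 2)"

lemma one_minus_square_expand:
  "1 - (x + y + z)\<^sup>2 = (\<Sum>e\<in>sq_exps. sq_coef e * (x ^ fst e * y ^ fst (snd e) * z ^ snd (snd e)))"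
  for x y z :: "'a::field"
  by (simp add: sq_exps_def sq_coef_def power2_eq_square algebra_simps)

text \<open>Grouping monomials by a common factor turns a sum over monomials into slices indexed by
  \<open>M\<close>.\<close>

lemma sum_group_factor:
  fixes f :: "'m \<Rightarrow> 'a::field"
  assumes "finite S" "finite M" "\<And>F. F \<in> S \<Longrightarrow> g F \<in> M"
  shows "(\<Sum>F\<in>S. f (g F) * h F) = (\<Sum>m\<in>M. f m * (\<Sum>F\<in>{F\<in>S. g F = m}. h F))"
proof -
  have "(\<Sum>m\<in>M. f m * (\<Sum>F\<in>{F\<in>S. g F = m}. h F))
      = (\<Sum>m\<in>M. \<Sum>F\<in>{F\<in>S. g F = m}. f (g F) * h F)"
    by (auto simp: sum_distrib_left intro!: sum.cong)
  also have "\<dots> = (\<Sum>F\<in>S. f (g F) * h F)"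
    using assms by (intro sum.group) auto
  finally show ?thesis by simp
qed

text \<open>The indicator of \<open>x i + y j + z k = 0\<close> is the diagonal tensor. It is a
  polynomial of degree at most \<open>2 * d\<close>, so in each monomial the part in
  \<open>x\<close>, in \<open>y\<close> or in \<open>z\<close> has degree at most
  \<open>2 * d / 3\<close>. Factoring out that part gives three families of slices.\<close>

lemma tricolored_sum_free_bound:
  fixes x y z :: "'i \<Rightarrow> nat \<Rightarrow> 'a::{field,finite}"
  assumes card3: "CARD('a) = 3" and fin: "finite I"
    and tri: "\<And>i j k. i \<in> I \<Longrightarrow> j \<in> I \<Longrightarrow> k \<in> I \<Longrightarrow>
      (\<forall>l<d. x i l + y j l + z k l = 0) \<longleftrightarrow> i = j \<and> j = k"
  shows "card I \<le> 3 * card (low_exponents d)"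
proof -
  \<comment> \<open>An element picks one monomial from each of the \<open>d\<close> factors;
    \<open>A\<close>, \<open>B\<close>, \<open>C\<close> are the exponents of the three parts of the
    product.\<close>
  define \<Omega> where "\<Omega> = ({..<d} \<rightarrow>\<^sub>E sq_exps)"
  define A where "A F = restrict (\<lambda>l. fst (F l)) {..<d}" for F :: "nat \<Rightarrow> nat \<times> nat \<times> nat"
  define B where "B F = restrict (\<lambda>l. fst (snd (F l))) {..<d}" for F :: "nat \<Rightarrow> nat \<times> nat \<times> nat"
  define C where "C F = restrict (\<lambda>l. snd (snd (F l))) {..<d}" for F :: "nat \<Rightarrow> nat \<times> nat \<times> nat"
  define M where "M = low_exponents d"
  define \<mu> where "\<mu> u a = (\<Prod>l<d. u l ^ a l)" for u :: "nat \<Rightarrow> 'a" and a :: "nat \<Rightarrow> nat"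
  define \<kappa> :: "(nat \<Rightarrow> nat \<times> nat \<times> nat) \<Rightarrow> 'a" where "\<kappa> F = (\<Prod>l<d. sq_coef (F l))" for F
  \<comment> \<open>Each monomial is assigned to the first of its parts with low degree, so that the
    three sums are disjoint.\<close>
  define S1 where "S1 = {F\<in>\<Omega>. A F \<in> M}"
  define S2 where "S2 = {F\<in>\<Omega>. A F \<notin> M \<and> B F \<in> M}"
  define S3 where "S3 = {F\<in>\<Omega>. A F \<notin> M \<and> B F \<notin> M}"
  have fin\<Omega>: "finite \<Omega>" unfolding \<Omega>_def by (intro finite_PiE) (auto simp: sq_exps_def)
  have finS: "finite S1" "finite S2" "finite S3"
    using fin\<Omega> by (auto simp: S1_def S2_def S3_def)
  \<comment> \<open>Two parts of degree above \<open>2 * d / 3\<close> leave less than that for the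
    third.\<close>
  have CM: "C F \<in> M" if "F \<in> S3" for F
  proof -
    have F: "F l \<in> sq_exps" if "l < d" for l
      using \<open>F \<in> S3\<close> that by (auto simp: S3_def \<Omega>_def PiE_def)
    have ABC: "A F \<in> {..<d} \<rightarrow>\<^sub>E {0, 1, 2}" "B F \<in> {..<d} \<rightarrow>\<^sub>E {0, 1, 2}" "C F \<in> {..<d} \<rightarrow>\<^sub>E {0, 1, 2}"
    proof -
      have "fst (F l) \<in> {0, 1, 2}" "fst (snd (F l)) \<in> {0, 1, 2}" "snd (snd (F l)) \<in> {0, 1, 2}"
        if "l < d" for l
        using F[OF that] by (auto simp: sq_exps_def)
      thus "A F \<in> {..<d} \<rightarrow>\<^sub>E {0, 1, 2}" "B F \<in> {..<d} \<rightarrow>\<^sub>E {0, 1, 2}" "C F \<in> {..<d} \<rightarrow>\<^sub>E {0, 1, 2}"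
        unfolding A_def B_def C_def restrict_PiE_iff by blast+
    qed
    have "(\<Sum>l<d. A F l) + (\<Sum>l<d. B F l) + (\<Sum>l<d. C F l)
        = (\<Sum>l<d. fst (F l) + fst (snd (F l)) + snd (snd (F l)))"
      by (simp add: A_def B_def C_def sum.distrib)
    also have "\<dots> \<le> (\<Sum>l<d. 2)"
    proof (rule sum_mono)
      fix l assume "l \<in> {..<d}"
      thus "fst (F l) + fst (snd (F l)) + snd (snd (F l)) \<le> 2"
        using F[of l] by (auto simp: sq_exps_def)
    qed
    finally have "(\<Sum>l<d. A F l) + (\<Sum>l<d. B F l) + (\<Sum>l<d. C F l) \<le> 2 * d" by simp
    thus ?thesis using \<open>F \<in> S3\<close> ABC by (auto simp: S3_def M_def low_exponents_def)
  qed
  have term_eq: "(\<Prod>l<d. sq_coef (F l) * (x i l ^ fst (F l) * y j l ^ fst (snd (F l)) * z k l ^ snd (snd (F l))))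
      = \<kappa> F * \<mu> (x i) (A F) * \<mu> (y j) (B F) * \<mu> (z k) (C F)" for F i j k
    by (simp add: \<kappa>_def \<mu>_def A_def B_def C_def prod.distrib mult.assoc)
  have "(if i = j \<and> j = k then 1 else 0) =
      (\<Sum>m\<in>M. \<mu> (x i) m * (\<Sum>F\<in>{F\<in>S1. A F = m}. \<kappa> F * \<mu> (y j) (B F) * \<mu> (z k) (C F)))
    + (\<Sum>m\<in>M. \<mu> (y j) m * (\<Sum>F\<in>{F\<in>S2. B F = m}. \<kappa> F * \<mu> (x i) (A F) * \<mu> (z k) (C F)))
    + (\<Sum>m\<in>M. \<mu> (z k) m * (\<Sum>F\<in>{F\<in>S3. C F = m}. \<kappa> F * \<mu> (x i) (A F) * \<mu> (y j) (B F)))"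
    if I: "i \<in> I" "j \<in> I" "k \<in> I" for i j k
  proof -
    define G where "G F = \<kappa> F * \<mu> (x i) (A F) * \<mu> (y j) (B F) * \<mu> (z k) (C F)" for F
    have ind: "1 - s\<^sup>2 = (if s = 0 then 1 else 0)" for s :: 'a
    proof -
      have "s \<in> {0, 1, -1}" unfolding CARD_3_UNIV(1)[OF card3, symmetric] by simp
      thus ?thesis by auto
    qed
    have "(if i = j \<and> j = k then 1 else 0) = (if \<forall>l<d. x i l + y j l + z k l = 0 then 1 else (0::'a))"
      using tri[OF I] by simp
    also have "\<dots> = (\<Prod>l<d. 1 - (x i l + y j l + z k l)\<^sup>2)"
      unfolding ind by (auto simp: prod_zero_iff)
    also have "\<dots> = (\<Sum>F\<in>\<Omega>. G F)"
      unfolding one_minus_square_expand G_def \<Omega>_def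
      by (subst prod_sum_PiE) (auto simp: term_eq sq_exps_def)
    also have "\<Omega> = S1 \<union> (S2 \<union> S3)" by (auto simp: S1_def S2_def S3_def)
    also have "(\<Sum>F\<in>S1 \<union> (S2 \<union> S3). G F) = (\<Sum>F\<in>S1. G F) + ((\<Sum>F\<in>S2. G F) + (\<Sum>F\<in>S3. G F))"
      using finS by (subst sum.union_disjoint; (subst sum.union_disjoint)?)
        (auto simp: S1_def S2_def S3_def)
    also have "(\<Sum>F\<in>S1. G F) = (\<Sum>F\<in>S1. \<mu> (x i) (A F) * (\<kappa> F * \<mu> (y j) (B F) * \<mu> (z k) (C F)))"
      by (simp add: G_def mult_ac)
    also have "\<dots> = (\<Sum>m\<in>M. \<mu> (x i) m * (\<Sum>F\<in>{F\<in>S1. A F = m}. \<kappa> F * \<mu> (y j) (B F) * \<mu> (z k) (C F)))"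
      by (rule sum_group_factor) (auto simp: finS M_def, auto simp: S1_def M_def)
    also have "(\<Sum>F\<in>S2. G F) = (\<Sum>F\<in>S2. \<mu> (y j) (B F) * (\<kappa> F * \<mu> (x i) (A F) * \<mu> (z k) (C F)))"
      by (simp add: G_def mult_ac)
    also have "\<dots> = (\<Sum>m\<in>M. \<mu> (y j) m * (\<Sum>F\<in>{F\<in>S2. B F = m}. \<kappa> F * \<mu> (x i) (A F) * \<mu> (z k) (C F)))"
      by (rule sum_group_factor) (auto simp: finS M_def, auto simp: S2_def M_def)
    also have "(\<Sum>F\<in>S3. G F) = (\<Sum>F\<in>S3. \<mu> (z k) (C F) * (\<kappa> F * \<mu> (x i) (A F) * \<mu> (y j) (B F)))"
      by (simp add: G_def mult_ac)
    also have "\<dots> = (\<Sum>m\<in>M. \<mu> (z k) m * (\<Sum>F\<in>{F\<in>S3. C F = m}. \<kappa> F * \<mu> (x i) (A F) * \<mu> (y j) (B F)))"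
      by (rule sum_group_factor) (use CM in \<open>auto simp: finS M_def\<close>)
    finally show ?thesis by (simp add: add.assoc)
  qed
  thus ?thesis
    unfolding M_def[symmetric]
    by (intro diagonal_tensor_bound[OF fin, where ?p = "\<lambda>m i. \<mu> (x i) m" and ?q = "\<lambda>m j. \<mu> (y j) m"
          and ?r = "\<lambda>m k. \<mu> (z k) m"
          and ?P = "\<lambda>m j k. \<Sum>F\<in>{F\<in>S1. A F = m}. \<kappa> F * \<mu> (y j) (B F) * \<mu> (z k) (C F)"
          and ?Q = "\<lambda>m i k. \<Sum>F\<in>{F\<in>S2. B F = m}. \<kappa> F * \<mu> (x i) (A F) * \<mu> (z k) (C F)"
          and ?R = "\<lambda>m i j. \<Sum>F\<in>{F\<in>S3. C F = m}. \<kappa> F * \<mu> (x i) (A F) * \<mu> (y j) (B F)"])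
      (simp_all add: M_def)
qed

section \<open>Counting exponents of low degree\<close>

lemma card_low_exponents_le:
  assumes x: "0 < x" "x < (1::real)"
  shows "card (low_exponents d) \<le> ((1 + x + x\<^sup>2) / x powr (2/3)) ^ d"
proof -
  \<comment> \<open>Each exponent is weighted by \<open>x\<close> to its degree. As
    \<open>x < 1\<close>, low degrees weigh at least \<open>x powr (2 / 3 * d)\<close>, while the
    weights of all exponents sum to \<open>(1 + x + x\<^sup>2) ^ d\<close>.\<close>
  have "card (low_exponents d) * (x powr (2/3)) ^ d = (\<Sum>a\<in>low_exponents d. (x powr (2/3)) ^ d)"
    by simp
  also have "\<dots> \<le> (\<Sum>a\<in>low_exponents d. \<Prod>l<d. x ^ a l)"
  proof (intro sum_mono)
    fix a assume "a \<in> low_exponents d"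
    hence "3 * real (\<Sum>l<d. a l) \<le> 2 * d"
      unfolding low_exponents_def using of_nat_mono[of "3 * (\<Sum>l<d. a l)" "2 * d"]
      by (metis (mono_tags, lifting) mem_Collect_eq of_nat_mult of_nat_numeral)
    hence "x powr (2/3 * d) \<le> x powr (\<Sum>l<d. a l)"
      using x by (intro powr_mono') auto
    also have "\<dots> = (\<Prod>l<d. x ^ a l)"
      using x by (subst powr_realpow) (auto simp: power_sum)
    finally show "(x powr (2/3)) ^ d \<le> (\<Prod>l<d. x ^ a l)"
      using x by (simp add: powr_powr flip: powr_realpow)
  qed
  also have "\<dots> \<le> (\<Sum>a\<in>{..<d} \<rightarrow>\<^sub>E {0, 1, 2}. \<Prod>l<d. x ^ a l)"
    using x by (intro sum_mono2 finite_PiE prod_nonneg) (auto simp: low_exponents_def)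
  also have "\<dots> = (\<Prod>l<d. \<Sum>e\<in>{0, 1, 2}. x ^ e)"
    by (subst prod_sum_PiE) auto
  also have "\<dots> = (1 + x + x\<^sup>2) ^ d" by (simp add: add.assoc)
  finally show ?thesis using x by (simp add: field_simps power_divide)
qed

lemma fp_gamma_bounds: "1 \<le> fp_gamma" "fp_gamma < 3"
proof -
  have ge: "1 \<le> (1 + x + x\<^sup>2) / x powr (2/3)" if "x \<in> {0<..<1}" for x :: real
  proof -
    have "x powr (2/3) \<le> 1" using that by (intro powr_le1) auto
    also have "1 \<le> 1 + x + x\<^sup>2" using that by simp
    finally show ?thesis using that by simp
  qed
  thus "1 \<le> fp_gamma" unfolding fp_gamma_def by (intro cINF_greatest) auto
  have "bdd_below ((\<lambda>x::real. (1 + x + x\<^sup>2) / x powr (2/3)) ` {0<..<1})"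
    using ge by (rule bdd_belowI2)
  \<comment> \<open>The point \<open>1/2\<close> suffices, though it is not the minimiser: its value
    is \<open>7/4 * 2 powr (2/3)\<close>.\<close>
  hence "fp_gamma \<le> (1 + 1/2 + (1/2)\<^sup>2) / (1/2) powr (2/3)"
    unfolding fp_gamma_def by (rule cINF_lower) simp
  also have "\<dots> < 3"
  proof -
    have "7/12 < (1/2 :: real) powr (2/3)"
    proof (rule power_less_imp_less_base[where n = 3])
      have "((1/2 :: real) powr (2/3)) ^ 3 = ((1/2) powr (2/3)) powr 3"
        by (simp add: powr_numeral)
      also have "\<dots> = (1/2) powr 2" unfolding powr_powr by simp
      also have "\<dots> = 1/4" by (simp add: power2_eq_square)
      finally show "(7/12 :: real) ^ 3 < ((1/2) powr (2/3)) ^ 3" by (simp add: power3_eq_cube)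
    qed auto
    thus ?thesis by (simp add: field_simps power2_eq_square)
  qed
  finally show "fp_gamma < 3" .
qed

text \<open>After taking \<open>d\<close>-th roots the count bounds every value in the infimum from
  below, so nothing has to be known about where it is attained. For \<open>d = 0\<close> the root
  carries no information.\<close>

lemma card_low_exponents_le_gamma: "card (low_exponents d) \<le> fp_gamma ^ d"
proof (cases "d = 0")
  case True
  thus ?thesis using card_low_exponents_le[of "1/2" d] by simp
next
  case False
  have "root d (card (low_exponents d)) \<le> fp_gamma"
    unfolding fp_gamma_def
  proof (intro cINF_greatest)
    fix x :: real assume x: "x \<in> {0<..<1}"
    have "root d (card (low_exponents d)) \<le> root d (((1 + x + x\<^sup>2) / x powr (2/3)) ^ d)"
      using False x card_low_exponents_le[of x d] by simp
    also have "\<dots> = (1 + x + x\<^sup>2) / x powr (2/3)"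
      using False x by (intro real_root_power_cancel) (auto intro!: divide_nonneg_nonneg add_nonneg_nonneg)
    finally show "root d (card (low_exponents d)) \<le> (1 + x + x\<^sup>2) / x powr (2/3)" .
  qed auto
  hence "root d (card (low_exponents d)) ^ d \<le> fp_gamma ^ d"
    by (intro power_mono real_root_ge_zero) auto
  thus ?thesis using False by simp
qed

section \<open>Supersaturation of three-term progressions\<close>

text \<open>Ordered zero-sum triples, given by their first two entries. In characteristic 3 these
  are the three-term progressions, trivial ones included, in a form symmetric in the
  entries.\<close>

definition zero_sum_pairs :: "(nat \<Rightarrow> 'a::field) set \<Rightarrow> ((nat \<Rightarrow> 'a) \<times> (nat \<Rightarrow> 'a)) set" where
  "zero_sum_pairs A = {(x, y). x \<in> A \<and> y \<in> A \<and> - x - y \<in> A}"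

lemma zero_sum_pairs_subset: "zero_sum_pairs A \<subseteq> A \<times> A"
  by (auto simp: zero_sum_pairs_def)

lemma finite_zero_sum_pairs [simp]: "finite A \<Longrightarrow> finite (zero_sum_pairs A)"
  using zero_sum_pairs_subset finite_subset by blast

lemma zero_sum_pairs_swap: "(x, y) \<in> zero_sum_pairs A \<Longrightarrow> (y, x) \<in> zero_sum_pairs A"
  using minus_diff_commute[of x y] by (simp add: zero_sum_pairs_def)

lemma zero_sum_pairs_rotate: "(x, y) \<in> zero_sum_pairs A \<Longrightarrow> (- x - y, x) \<in> zero_sum_pairs A"
  by (simp add: zero_sum_pairs_def)

section \<open>Uniformly random linear maps, given by their columns\<close>

definition comb_map :: "nat \<Rightarrow> (nat \<Rightarrow> nat \<Rightarrow> 'a::field) \<Rightarrow> (nat \<Rightarrow> 'a) \<Rightarrow> nat \<Rightarrow> 'a" where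
  "comb_map d c u = (\<lambda>i. \<Sum>l<d. u l * c l i)"

lemma comb_map_add: "comb_map d c (u + v) = comb_map d c u + comb_map d c v"
  by (rule ext) (simp add: comb_map_def distrib_right sum.distrib)

lemma comb_map_vscale: "comb_map d c (vscale p u) = vscale p (comb_map d c u)"
  by (rule ext) (simp add: comb_map_def sum_distrib_left mult.assoc)

lemma comb_map_fvec: "c \<in> {..<d} \<rightarrow>\<^sub>E fvec n \<Longrightarrow> comb_map d c u \<in> fvec n"
  by (auto simp: comb_map_def fvec_def PiE_def Pi_def intro!: sum.neutral)

text \<open>Some coordinate \<open>e l\<close> is invertible, so the value \<open>g\<close> and the
  other columns determine column \<open>l\<close>. A random map thus takes each value at
  \<open>e\<close> with probability at most \<open>1 / q ^ n\<close>.\<close>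

lemma card_comb_map_fibre:
  fixes e :: "nat \<Rightarrow> 'a::{field,finite}"
  assumes "e \<in> fvec d" "e \<noteq> 0"
  shows "card {c \<in> {..<d} \<rightarrow>\<^sub>E fvec n. comb_map d c e = g} * CARD('a) ^ n \<le> (CARD('a) ^ n) ^ d"
proof -
  obtain l where l: "e l \<noteq> 0" using assms(2) by (metis ext zero_fun_apply)
  hence ld: "l < d" using assms(1) by (auto simp: fvec_def not_less[symmetric])
  let ?X = "{c \<in> {..<d} \<rightarrow>\<^sub>E fvec n. comb_map d c e = g}"
  let ?r = "\<lambda>c :: nat \<Rightarrow> nat \<Rightarrow> 'a. restrict c ({..<d} - {l})"
  have "inj_on ?r ?X"
  proof (rule inj_onI)
    fix c c' assume c: "c \<in> ?X" "c' \<in> ?X" and eq: "?r c = ?r c'"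
    have same: "c m = c' m" if "m < d" "m \<noteq> l" for m
      using fun_cong[OF eq, of m] that by simp
    have "c l i = c' l i" for i
    proof -
      have expand: "comb_map d b e i = e l * b l i + (\<Sum>m\<in>{..<d} - {l}. e m * b m i)" for b
        unfolding comb_map_def using ld by (subst sum.remove[of _ l]) auto
      have "comb_map d c e i = comb_map d c' e i" using c by simp
      moreover have "(\<Sum>m\<in>{..<d} - {l}. e m * c m i) = (\<Sum>m\<in>{..<d} - {l}. e m * c' m i)"
        using same by (intro sum.cong) auto
      ultimately have "e l * c l i = e l * c' l i" unfolding expand by simp
      thus ?thesis using l by simp
    qed
    hence "c m = c' m" if "m < d" for m using same that by (cases "m = l") auto
    thus "c = c'" using c by (intro PiE_ext[of c "{..<d}" "\<lambda>_. fvec n" c']) auto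
  qed
  moreover have "?r ` ?X \<subseteq> ({..<d} - {l}) \<rightarrow>\<^sub>E fvec n"
    by (intro image_subsetI restrict_PiE_iff[THEN iffD2]) (auto simp: PiE_def Pi_def)
  ultimately have "card ?X \<le> card (({..<d} - {l}) \<rightarrow>\<^sub>E (fvec n :: (nat \<Rightarrow> 'a) set))"
    by (intro card_inj_on_le[of ?r] finite_PiE) auto
  also have "\<dots> = (CARD('a) ^ n) ^ (d - 1)"
    using ld by (subst card_PiE) (auto simp: card_fvec)
  finally have "card ?X * CARD('a) ^ n \<le> (CARD('a) ^ n) ^ (d - 1) * CARD('a) ^ n" by simp
  also have "\<dots> = (CARD('a) ^ n) ^ d" using ld by (cases d) (simp_all add: mult.commute)
  finally show ?thesis .
qed

text \<open>Two zero-sum triples that agree in the first, second or third entry differ in the other two by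
  \<open>(e, - e)\<close>. A triple is encoded by its first two entries, hence these three multipliers of \<open>e\<close>.\<close>

definition shifts :: "('a::field \<times> 'a) set" where
  "shifts = {(0, 1), (1, 0), (1, - 1)}"

lemma card_shifts_le: "card shifts \<le> 3"
  unfolding shifts_def by (intro card_insert_le_m1) auto

text \<open>Each shift leaves one entry of the triple fixed. By symmetry this entry can be moved to
  the front, and distinct \<open>g\<close> then give distinct partners of it, of which there are at
  most \<open>D\<close>.\<close>

lemma card_shift_fibre:
  fixes A :: "(nat \<Rightarrow> 'a::field) set"
  assumes fin: "finite A" and D: "\<And>x. x \<in> A \<Longrightarrow> card {y. (x, y) \<in> zero_sum_pairs A} \<le> D"
    and xy: "(x, y) \<in> zero_sum_pairs A" and pr: "(p, r) \<in> shifts"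
  shows "finite {g. (x + vscale p g, y + vscale r g) \<in> zero_sum_pairs A} \<and>
    card {g. (x + vscale p g, y + vscale r g) \<in> zero_sum_pairs A} \<le> D"
proof -
  let ?G = "{g. (x + vscale p g, y + vscale r g) \<in> zero_sum_pairs A}"
  \<comment> \<open>\<open>w\<close> is the entry that the shift fixes, \<open>b + g\<close> another
    entry of the shifted triple.\<close>
  obtain w b where wb: "w \<in> A" "\<And>g. g \<in> ?G \<Longrightarrow> (w, b + g) \<in> zero_sum_pairs A"
  proof -
    consider "p = 0" "r = 1" | "p = 1" "r = 0" | "p = 1" "r = -1" using pr by (auto simp: shifts_def)
    thus thesis
    proof cases
      case 1
      thus ?thesis using that[of x y] xy by (simp add: zero_sum_pairs_def)
    next
      case 2
      hence "(y, x + g) \<in> zero_sum_pairs A" if "g \<in> ?G" for g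
        using that by (auto intro: zero_sum_pairs_swap)
      thus ?thesis using that[of y x] xy by (simp add: zero_sum_pairs_def)
    next
      case 3
      have "(- x - y, x + g) \<in> zero_sum_pairs A" if "g \<in> ?G" for g
        using zero_sum_pairs_rotate[of "x + g" "y - g" A] that 3
        by simp
      thus ?thesis using that[of "- x - y" x] xy by (simp add: zero_sum_pairs_def)
    qed
  qed
  have finw: "finite {y. (w, y) \<in> zero_sum_pairs A}"
    using fin by (intro finite_subset[OF _ fin]) (auto simp: zero_sum_pairs_def)
  have inj: "inj_on ((+) b) ?G" by simp
  have sub: "(+) b ` ?G \<subseteq> {y. (w, y) \<in> zero_sum_pairs A}" using wb(2) by blast
  have "card ?G \<le> card {y. (w, y) \<in> zero_sum_pairs A}"
    by (rule card_inj_on_le[OF inj sub finw])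
  moreover have "finite ?G" by (rule inj_on_finite[OF inj sub finw])
  ultimately show ?thesis using D[OF wb(1)] by linarith
qed

lemma sum_card_swap:
  assumes "finite X" "finite Y"
  shows "(\<Sum>x\<in>X. card {y \<in> Y. P x y}) = (\<Sum>y\<in>Y. card {x \<in> X. P x y})"
  using sum.swap_restrict[OF assms, of "\<lambda>_ _. 1 :: nat" P] by simp

text \<open>The random maps are \<open>u \<mapsto> a + L u\<close>, \<open>v \<mapsto> b + L v\<close> and \<open>w \<mapsto> L w - (a + b)\<close> on the three entries of
  a zero-sum triple. Separate translations make the image of every pair \<open>(u, v)\<close> uniform, even if
  \<open>u\<close> and \<open>v\<close> are equal or dependent.\<close>

lemma sampling_bound:
  fixes A :: "(nat \<Rightarrow> 'a::{field,finite}) set"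
  assumes card3: "CARD('a) = 3" and A: "A \<subseteq> fvec n"
    and D: "\<And>x. x \<in> A \<Longrightarrow> card {y. (x, y) \<in> zero_sum_pairs A} \<le> D"
    and d: "6 * 3 ^ d * D \<le> 3 ^ n"
  shows "9 ^ d * card (zero_sum_pairs A) \<le> 6 * card (low_exponents d) * (3 ^ n)\<^sup>2"
proof -
  define N :: nat where "N = 3 ^ n"
  define G where "G = (fvec n :: (nat \<Rightarrow> 'a) set)"
  define E where "E = (fvec d :: (nat \<Rightarrow> 'a) set)"
  define T where "T = zero_sum_pairs A"
  define Cs where "Cs = ({..<d} \<rightarrow>\<^sub>E G)"
  \<comment> \<open>The sample space consists of both translations and the columns of the linear
    map; probabilities are expressed by counting outcomes. \<open>S \<omega> uv\<close> says that
    the image of \<open>uv\<close> lies in \<open>T\<close>.\<close>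
  define \<Omega> where "\<Omega> = G \<times> G \<times> Cs"
  define S where "S \<omega> uv \<longleftrightarrow> (fst \<omega> + comb_map d (snd (snd \<omega>)) (fst uv),
      fst (snd \<omega>) + comb_map d (snd (snd \<omega>)) (snd uv)) \<in> T"
    for \<omega> :: "(nat \<Rightarrow> 'a) \<times> (nat \<Rightarrow> 'a) \<times> (nat \<Rightarrow> nat \<Rightarrow> 'a)" and uv
  define sh where "sh pr e uv = (fst uv + vscale (fst pr) e, snd uv + vscale (snd pr) e)"
    for pr :: "'a \<times> 'a" and e :: "nat \<Rightarrow> 'a" and uv
  define Z where "Z = (shifts :: ('a \<times> 'a) set) \<times> (E - {0})"
  \<comment> \<open>Survivors that share no entry with another survivor in the same
    position.\<close>
  define Iso where "Iso \<omega> = {uv \<in> E \<times> E. S \<omega> uv \<and> (\<forall>(pr, e) \<in> Z. \<not> S \<omega> (sh pr e uv))}" for \<omega>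
  have finA: "finite A" using A finite_fvec finite_subset by blast
  have fin: "finite G" "finite E" "finite T" "finite Cs" "finite \<Omega>" "finite Z"
    using finA by (auto simp: G_def E_def T_def Cs_def \<Omega>_def Z_def shifts_def
        intro!: finite_PiE finite_cartesian_product)
  have cards: "card G = N" "card E = 3 ^ d" "card Cs = N ^ d" "card \<Omega> = N ^ d * N\<^sup>2"
    by (auto simp: G_def E_def Cs_def \<Omega>_def card_fvec card3 N_def card_PiE card_cartesian_product
        power2_eq_square)
  have cardZ: "card Z \<le> 3 * 3 ^ d"
    unfolding Z_def card_cartesian_product using fin(2) cards(2)
    by (intro mult_mono card_shifts_le) (auto intro: order_trans[OF card_Diff1_le])
  have TG: "x \<in> G" "y \<in> G" if "(x, y) \<in> T" for x y
    using that A zero_sum_pairs_subset[of A] by (auto simp: T_def G_def)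
  have cG: "comb_map d c u \<in> G" if "c \<in> Cs" for c u
    using that comb_map_fvec by (auto simp: G_def Cs_def)
  \<comment> \<open>For fixed columns the translations can be solved for any prescribed image
    pair.\<close>
  have count1: "N ^ d * card T \<le> card {\<omega> \<in> \<Omega>. S \<omega> uv}" for uv
  proof -
    let ?f = "\<lambda>((x, y), c). (x - comb_map d c (fst uv), y - comb_map d c (snd uv), c)"
    have "inj_on ?f (T \<times> Cs)" by (rule inj_onI) auto
    moreover have "?f ` (T \<times> Cs) \<subseteq> {\<omega> \<in> \<Omega>. S \<omega> uv}"
    proof (rule image_subsetI)
      fix z assume "z \<in> T \<times> Cs"
      then obtain x y c where z: "z = ((x, y), c)" "(x, y) \<in> T" "c \<in> Cs" by auto
      thus "?f z \<in> {\<omega> \<in> \<Omega>. S \<omega> uv}"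
        using TG[OF z(2)] cG[OF z(3)] by (simp add: \<Omega>_def S_def G_def)
    qed
    ultimately have "card (T \<times> Cs) \<le> card {\<omega> \<in> \<Omega>. S \<omega> uv}"
      using fin(5) by (intro card_inj_on_le[of ?f]) auto
    thus ?thesis by (simp add: card_cartesian_product cards mult.commute)
  qed
  \<comment> \<open>Given the image of the first triple, the second survives only if the linear map
    sends \<open>e\<close> into a set of at most \<open>D\<close> values, each of probability at
    most \<open>1 / N\<close>.\<close>
  have count2: "card {\<omega> \<in> \<Omega>. S \<omega> uv \<and> S \<omega> (sh pr e uv)} * N \<le> N ^ d * card T * D"
    if pre: "(pr, e) \<in> Z" for uv pr e
  proof -
    obtain p r where pr: "pr = (p, r)" "(p, r) \<in> shifts" using pre by (cases pr) (auto simp: Z_def)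
    have e: "e \<in> fvec d" "e \<noteq> 0" using pre by (auto simp: Z_def E_def)
    define \<Gamma> where "\<Gamma> xy = {g. (fst xy + vscale p g, snd xy + vscale r g) \<in> T}" for xy
    have \<Gamma>: "finite (\<Gamma> xy)" "card (\<Gamma> xy) \<le> D" if "xy \<in> T" for xy
      using card_shift_fibre[OF finA D _ pr(2), of "fst xy" "snd xy"] that
      by (simp_all add: \<Gamma>_def T_def)
    let ?f = "\<lambda>(a, b, c). ((a + comb_map d c (fst uv), b + comb_map d c (snd uv)), c)"
    let ?Y = "SIGMA xy:T. {c \<in> Cs. comb_map d c e \<in> \<Gamma> xy}"
    have finY: "finite ?Y" using fin by (intro finite_SigmaI) auto
    have "inj_on ?f {\<omega> \<in> \<Omega>. S \<omega> uv \<and> S \<omega> (sh pr e uv)}" by (rule inj_onI) auto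
    moreover have "?f ` {\<omega> \<in> \<Omega>. S \<omega> uv \<and> S \<omega> (sh pr e uv)} \<subseteq> ?Y"
    proof (rule image_subsetI)
      fix \<omega> assume w: "\<omega> \<in> {\<omega> \<in> \<Omega>. S \<omega> uv \<and> S \<omega> (sh pr e uv)}"
      obtain a b c where abc: "\<omega> = (a, b, c)" by (cases \<omega>)
      show "?f \<omega> \<in> ?Y"
        using w unfolding abc
        by (simp add: S_def sh_def \<Omega>_def \<Gamma>_def pr comb_map_add comb_map_vscale add.assoc)
    qed
    ultimately have "card {\<omega> \<in> \<Omega>. S \<omega> uv \<and> S \<omega> (sh pr e uv)} \<le> card ?Y"
      using finY by (intro card_inj_on_le[of ?f])
    also have "card ?Y = (\<Sum>xy\<in>T. card {c \<in> Cs. comb_map d c e \<in> \<Gamma> xy})"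
      using fin by (intro card_SigmaI) auto
    finally have "card {\<omega> \<in> \<Omega>. S \<omega> uv \<and> S \<omega> (sh pr e uv)} * N
        \<le> (\<Sum>xy\<in>T. card {c \<in> Cs. comb_map d c e \<in> \<Gamma> xy}) * N" by simp
    also have "\<dots> = (\<Sum>xy\<in>T. card {c \<in> Cs. comb_map d c e \<in> \<Gamma> xy} * N)"
      by (rule sum_distrib_right)
    also have "\<dots> \<le> (\<Sum>xy\<in>T. N ^ d * D)"
    proof (rule sum_mono)
      fix xy assume xy: "xy \<in> T"
      have "{c \<in> Cs. comb_map d c e \<in> \<Gamma> xy} = (\<Union>g\<in>\<Gamma> xy. {c \<in> Cs. comb_map d c e = g})" by auto
      hence "card {c \<in> Cs. comb_map d c e \<in> \<Gamma> xy} \<le> (\<Sum>g\<in>\<Gamma> xy. card {c \<in> Cs. comb_map d c e = g})"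
        using card_UN_le[OF \<Gamma>(1)[OF xy]] by simp
      hence "card {c \<in> Cs. comb_map d c e \<in> \<Gamma> xy} * N
          \<le> (\<Sum>g\<in>\<Gamma> xy. card {c \<in> Cs. comb_map d c e = g}) * N" by simp
      also have "\<dots> = (\<Sum>g\<in>\<Gamma> xy. card {c \<in> Cs. comb_map d c e = g} * N)"
        by (rule sum_distrib_right)
      also have "\<dots> \<le> (\<Sum>g\<in>\<Gamma> xy. N ^ d)"
        using card_comb_map_fibre[OF e, of n] by (intro sum_mono) (simp add: Cs_def G_def card3 N_def)
      also have "\<dots> \<le> N ^ d * D" using \<Gamma>(2)[OF xy] by (simp add: mult.commute)
      finally show "card {c \<in> Cs. comb_map d c e \<in> \<Gamma> xy} * N \<le> N ^ d * D" .
    qed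
    finally show ?thesis by (simp add: mult_ac)
  qed
  \<comment> \<open>If \<open>i\<close>, \<open>j\<close>, \<open>k\<close> satisfy the zero-sum
    relation, the pair with first entry from \<open>i\<close> and second entry from \<open>j\<close>
    has the third entry of \<open>k\<close> and survives. It shares an entry with each of the three,
    so isolation makes it equal to all of them.\<close>
  have iso: "card (Iso \<omega>) \<le> 3 * card (low_exponents d)" if "\<omega> \<in> \<Omega>" for \<omega>
  proof (rule tricolored_sum_free_bound[OF card3, where x = fst and y = snd and z = "\<lambda>uv. - (fst uv + snd uv)"])
    show "finite (Iso \<omega>)" using fin by (simp add: Iso_def)
  next
    fix i j k assume I: "i \<in> Iso \<omega>" "j \<in> Iso \<omega>" "k \<in> Iso \<omega>"
    obtain a b c where abc: "\<omega> = (a, b, c)" by (cases \<omega>)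
    obtain u1 v1 u2 v2 u3 v3 where uv: "i = (u1, v1)" "j = (u2, v2)" "k = (u3, v3)"
      by (metis surj_pair)
    have E: "u1 \<in> E" "v1 \<in> E" "u2 \<in> E" "v2 \<in> E" "u3 \<in> E" "v3 \<in> E"
      using I by (auto simp: Iso_def uv)
    let ?L = "comb_map d c"
    have isoD: "e = 0" if "uv \<in> Iso \<omega>" "S \<omega> (sh pr e uv)" "pr \<in> shifts" "e \<in> E" for uv pr e
      using that by (auto simp: Iso_def Z_def)
    show "(\<forall>l<d. fst i l + snd j l + (- (fst k + snd k)) l = 0) \<longleftrightarrow> i = j \<and> j = k"
    proof
      assume "i = j \<and> j = k"
      thus "\<forall>l<d. fst i l + snd j l + (- (fst k + snd k)) l = 0" by simp
    next
      assume zero: "\<forall>l<d. fst i l + snd j l + (- (fst k + snd k)) l = 0"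
      have eq: "u1 + v2 = u3 + v3"
      proof
        fix l
        show "(u1 + v2) l = (u3 + v3) l"
        proof (cases "l < d")
          case True
          thus ?thesis using zero by (simp add: uv algebra_simps)
        next
          case False
          thus ?thesis using E by (simp add: E_def fvec_def)
        qed
      qed
      have T1: "(a + ?L u1, b + ?L v1) \<in> T" "(a + ?L u2, b + ?L v2) \<in> T" "(a + ?L u3, b + ?L v3) \<in> T"
        using I by (simp_all add: Iso_def S_def abc uv)
      have "- (a + ?L u1) - (b + ?L v2) = - (a + b) - ?L (u1 + v2)"
        by (simp add: comb_map_add algebra_simps)
      also have "\<dots> = - (a + ?L u3) - (b + ?L v3)"
        unfolding eq by (simp add: comb_map_add algebra_simps)
      finally have "- (a + ?L u1) - (b + ?L v2) \<in> A"
        using T1(3) by (simp only: T_def zero_sum_pairs_def mem_Collect_eq split_conv)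
      hence "(a + ?L u1, b + ?L v2) \<in> T"
        using T1(1,2) by (simp only: T_def zero_sum_pairs_def mem_Collect_eq split_conv)
      hence S12: "S \<omega> (u1, v2)" by (simp add: S_def abc)
      have "sh (0, 1) (v2 - v1) i = (u1, v2)" by (simp add: sh_def uv)
      hence e1: "v2 - v1 = 0"
        using isoD[OF I(1), of "(0, 1)" "v2 - v1"] S12 E by (simp add: shifts_def E_def)
      have "sh (1, 0) (u1 - u2) j = (u1, v2)" by (simp add: sh_def uv)
      hence e2: "u1 - u2 = 0"
        using isoD[OF I(2), of "(1, 0)" "u1 - u2"] S12 E by (simp add: shifts_def E_def)
      have "v3 + (u3 - u1) = v2" using eq by (simp add: algebra_simps)
      hence "sh (1, - 1) (u1 - u3) k = (u1, v2)" by (simp add: sh_def uv)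
      hence e3: "u1 - u3 = 0"
        using isoD[OF I(3), of "(1, - 1)" "u1 - u3"] S12 E by (simp add: shifts_def E_def)
      show "i = j \<and> j = k" using e1 e2 e3 eq by (simp add: uv)
    qed
  qed
  \<comment> \<open>A survivor that is not isolated collides with one of its shifts; a union bound
    over \<open>Z\<close> follows.\<close>
  have split: "card {uv \<in> E \<times> E. S \<omega> uv}
      \<le> card (Iso \<omega>) + (\<Sum>z\<in>Z. card {uv \<in> E \<times> E. S \<omega> uv \<and> S \<omega> (sh (fst z) (snd z) uv)})" for \<omega>
  proof -
    have "{uv \<in> E \<times> E. S \<omega> uv}
        \<subseteq> Iso \<omega> \<union> (\<Union>z\<in>Z. {uv \<in> E \<times> E. S \<omega> uv \<and> S \<omega> (sh (fst z) (snd z) uv)})"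
      by (auto simp: Iso_def)
    hence "card {uv \<in> E \<times> E. S \<omega> uv}
        \<le> card (Iso \<omega> \<union> (\<Union>z\<in>Z. {uv \<in> E \<times> E. S \<omega> uv \<and> S \<omega> (sh (fst z) (snd z) uv)}))"
      using fin by (intro card_mono) (auto simp: Iso_def)
    also have "\<dots> \<le> card (Iso \<omega>) + card (\<Union>z\<in>Z. {uv \<in> E \<times> E. S \<omega> uv \<and> S \<omega> (sh (fst z) (snd z) uv)})"
      by (rule card_Un_le)
    also have "card (\<Union>z\<in>Z. {uv \<in> E \<times> E. S \<omega> uv \<and> S \<omega> (sh (fst z) (snd z) uv)})
        \<le> (\<Sum>z\<in>Z. card {uv \<in> E \<times> E. S \<omega> uv \<and> S \<omega> (sh (fst z) (snd z) uv)})"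
      by (rule card_UN_le[OF fin(6)])
    finally show ?thesis by simp
  qed
  have EE: "card (E \<times> E) = 9 ^ d"
    by (simp add: card_cartesian_product cards flip: power_mult_distrib)
  have finEE: "finite (E \<times> E)" using fin by simp
  \<comment> \<open>Double counting of surviving pairs. The extra factor \<open>N\<close> clears the
    denominator in \<open>count2\<close>.\<close>
  have "N * (9 ^ d * (N ^ d * card T)) = N * (\<Sum>uv\<in>E \<times> E. N ^ d * card T)" by (simp add: EE)
  also have "\<dots> \<le> N * (\<Sum>uv\<in>E \<times> E. card {\<omega> \<in> \<Omega>. S \<omega> uv})"
    by (intro mult_left_mono sum_mono count1) simp
  also have "(\<Sum>uv\<in>E \<times> E. card {\<omega> \<in> \<Omega>. S \<omega> uv}) = (\<Sum>\<omega>\<in>\<Omega>. card {uv \<in> E \<times> E. S \<omega> uv})"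
    by (rule sum_card_swap[OF finEE fin(5)])
  also have "N * (\<Sum>\<omega>\<in>\<Omega>. card {uv \<in> E \<times> E. S \<omega> uv})
      \<le> N * (\<Sum>\<omega>\<in>\<Omega>. card (Iso \<omega>) + (\<Sum>z\<in>Z. card {uv \<in> E \<times> E. S \<omega> uv \<and> S \<omega> (sh (fst z) (snd z) uv)}))"
    by (intro mult_left_mono sum_mono split) simp
  also have "(\<Sum>\<omega>\<in>\<Omega>. card (Iso \<omega>) + (\<Sum>z\<in>Z. card {uv \<in> E \<times> E. S \<omega> uv \<and> S \<omega> (sh (fst z) (snd z) uv)}))
      = (\<Sum>\<omega>\<in>\<Omega>. card (Iso \<omega>)) + (\<Sum>z\<in>Z. \<Sum>\<omega>\<in>\<Omega>. card {uv \<in> E \<times> E. S \<omega> uv \<and> S \<omega> (sh (fst z) (snd z) uv)})"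
    unfolding sum.distrib by (subst sum.swap) (rule refl)
  also have "\<dots> = (\<Sum>\<omega>\<in>\<Omega>. card (Iso \<omega>)) + (\<Sum>z\<in>Z. \<Sum>uv\<in>E \<times> E. card {\<omega> \<in> \<Omega>. S \<omega> uv \<and> S \<omega> (sh (fst z) (snd z) uv)})"
    by (intro arg_cong2[where f = "(+)"] refl sum.cong sum_card_swap finEE fin)
  also have "N * \<dots> = N * (\<Sum>\<omega>\<in>\<Omega>. card (Iso \<omega>)) + (\<Sum>z\<in>Z. \<Sum>uv\<in>E \<times> E. card {\<omega> \<in> \<Omega>. S \<omega> uv \<and> S \<omega> (sh (fst z) (snd z) uv)} * N)"
    by (simp only: distrib_left sum_distrib_left mult.commute[of N])
  also have "\<dots> \<le> N * (\<Sum>\<omega>\<in>\<Omega>. 3 * card (low_exponents d)) + (\<Sum>z\<in>Z. \<Sum>uv\<in>E \<times> E. N ^ d * card T * D)"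
    by (intro add_mono mult_left_mono sum_mono iso count2) auto
  also have "\<dots> = N * (N ^ d * N\<^sup>2 * (3 * card (low_exponents d))) + card Z * (9 ^ d * (N ^ d * card T * D))"
    by (simp only: sum_constant cards EE of_nat_id)
  also have "\<dots> \<le> N * (N ^ d * N\<^sup>2 * (3 * card (low_exponents d))) + (3 * 3 ^ d) * (9 ^ d * (N ^ d * card T * D))"
    using cardZ by (intro add_mono mult_right_mono) auto
  finally have main: "N * (9 ^ d * (N ^ d * card T))
      \<le> N * (N ^ d * N\<^sup>2 * (3 * card (low_exponents d))) + (3 * 3 ^ d) * (9 ^ d * (N ^ d * card T * D))" .
  \<comment> \<open>The hypothesis on \<open>d\<close> keeps the collisions to at most half of the
    left side of \<open>main\<close>, so the isolated survivors account for the other half.\<close>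
  have "(6 * 3 ^ d * D) * (9 ^ d * (N ^ d * card T)) \<le> N * (9 ^ d * (N ^ d * card T))"
    using d unfolding N_def by (intro mult_right_mono) auto
  hence "2 * ((3 * 3 ^ d) * (9 ^ d * (N ^ d * card T * D))) \<le> N * (9 ^ d * (N ^ d * card T))"
    by (simp add: mult_ac)
  with main have "N * (9 ^ d * (N ^ d * card T)) \<le> 2 * (N * (N ^ d * N\<^sup>2 * (3 * card (low_exponents d))))"
    by linarith
  hence "(N * N ^ d) * (9 ^ d * card T) \<le> (N * N ^ d) * (6 * card (low_exponents d) * N\<^sup>2)"
    by (simp add: mult_ac)
  moreover have "0 < N * N ^ d" by (simp add: N_def)
  ultimately have "9 ^ d * card T \<le> 6 * card (low_exponents d) * N\<^sup>2"
    by (simp only: mult_le_cancel1)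
  thus ?thesis by (simp add: T_def N_def)
qed

section \<open>A power law for the number of zero-sum triples\<close>

lemma C0_facts: "0 < 1 - log 3 fp_gamma" "1 - log 3 fp_gamma \<le> 1" "2 \<le> C0"
  "fp_gamma = 3 powr (log 3 fp_gamma)"
proof -
  have "0 \<le> log 3 fp_gamma" using fp_gamma_bounds by simp
  moreover have "log 3 fp_gamma < log 3 3" using fp_gamma_bounds by (intro log_less) auto
  ultimately show *: "0 < 1 - log 3 fp_gamma" "1 - log 3 fp_gamma \<le> 1" by auto
  thus "2 \<le> C0" unfolding C0_def by (simp add: field_simps)
  show "fp_gamma = 3 powr (log 3 fp_gamma)" using fp_gamma_bounds by simp
qed

text \<open>With \<alpha> and \<delta> the densities of \<open>A\<close> and of its triples,
  sampling works while \<open>3 ^ d\<close> is at most about \<open>\<alpha> / \<delta>\<close>, and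
  it gives \<open>3 powr (d * (1 + \<kappa>)) * \<delta> \<le> 6\<close>. The largest such
  \<open>d\<close> bounds \<delta> from below by a multiple of \<alpha> to the power
  \<open>1 + 1 / \<kappa>\<close>, which is \<open>C0\<close>.\<close>

lemma bounded_degree_bound:
  fixes A :: "(nat \<Rightarrow> 'a::{field,finite}) set" and s :: real
  assumes card3: "CARD('a) = 3" and A: "A \<subseteq> fvec n" "A \<noteq> {}" and s: "1 \<le> s"
    and deg: "\<And>x. x \<in> A \<Longrightarrow>
      card {y. (x, y) \<in> zero_sum_pairs A} * real (card A) \<le> s * card (zero_sum_pairs A)"
  shows "1 / (18 * s) * (1 / (108 * s)) powr (C0 - 1) * (card A / 3 ^ n) powr C0 * (3 ^ n)\<^sup>2
    \<le> card (zero_sum_pairs A)"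
proof -
  define \<kappa> where "\<kappa> = 1 - log 3 fp_gamma"
  define N :: real where "N = 3 ^ n"
  define \<alpha> where "\<alpha> = card A / N"
  define \<delta> where "\<delta> = card (zero_sum_pairs A) / N\<^sup>2"
  have \<kappa>: "0 < \<kappa>" "C0 - 1 = 1 / \<kappa>" "C0 = 1 + 1 / \<kappa>" using C0_facts by (auto simp: \<kappa>_def C0_def)
  have N: "0 < N" by (simp add: N_def)
  have finA: "finite A" using A finite_fvec finite_subset by blast
  hence cA: "0 < card A" using A by (simp add: card_gt_0_iff)
  have "card A \<le> 3 ^ n" using card_mono[OF finite_fvec A(1)] by (simp add: card_fvec card3)
  hence "real (card A) \<le> N" unfolding N_def by (metis of_nat_le_iff of_nat_numeral of_nat_power)
  hence \<alpha>: "0 < \<alpha>" "\<alpha> \<le> 1" using cA N by (auto simp: \<alpha>_def)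
  \<comment> \<open>The trivial triple \<open>x, x, x\<close> sums to zero in characteristic 3,
    which keeps \<delta> positive.\<close>
  have T0: "0 < card (zero_sum_pairs A)"
  proof -
    obtain x where x: "x \<in> A" using A by blast
    have two: "x i + x i = - x i" for i
    proof -
      have "x i + x i = x i * (1 + 1)" by (simp only: distrib_left mult_1_right)
      thus ?thesis unfolding CARD_3_UNIV(2)[OF card3] by simp
    qed
    have "- x - x = x"
    proof
      fix i
      have "(- x - x) i = - (x i + x i)" by (simp only: minus_apply uminus_apply) simp
      thus "(- x - x) i = x i" unfolding two by simp
    qed
    hence "(x, x) \<in> zero_sum_pairs A"
      using x by (simp only: zero_sum_pairs_def mem_Collect_eq split_conv)
    thus ?thesis using finA by (auto simp: card_gt_0_iff)
  qed
  hence \<delta>: "0 < \<delta>" using N by (simp add: \<delta>_def)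
  \<comment> \<open>The largest value of \<open>3 ^ d\<close> for which the degree bound
    \<open>s * \<delta> / \<alpha> * N\<close> fits the hypothesis of
    \<open>sampling_bound\<close>.\<close>
  define X where "X = \<alpha> / (6 * s * \<delta>)"
  have X: "0 < X" using \<alpha> \<delta> s by (simp add: X_def)
  have "1 / (18 * s) * (1 / (108 * s)) powr (1 / \<kappa>) * \<alpha> powr (1 + 1 / \<kappa>) \<le> \<delta>"
  proof (cases "X < 1")
    \<comment> \<open>Not even \<open>d = 0\<close> is admissible here, but then \<delta> exceeds
      \<open>\<alpha> / (6 * s)\<close>, which is linear in \<alpha>.\<close>
    case True
    have "1 / (18 * s) * (1 / (108 * s)) powr (1 / \<kappa>) * \<alpha> powr (1 + 1 / \<kappa>) \<le> 1 / (18 * s) * 1 * \<alpha>"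
    proof (intro mult_mono)
      show "(1 / (108 * s)) powr (1 / \<kappa>) \<le> 1" using s \<kappa> by (intro powr_le1) auto
      have "\<alpha> powr (1 + 1 / \<kappa>) \<le> \<alpha> powr 1" using \<alpha> \<kappa>(1) by (intro powr_mono') auto
      thus "\<alpha> powr (1 + 1 / \<kappa>) \<le> \<alpha>" using \<alpha> by simp
    qed (use s in auto)
    also have "\<dots> \<le> \<alpha> / (6 * s)" using s \<alpha> by (simp add: field_simps)
    also have "\<dots> \<le> \<delta>" using True s \<delta> by (simp add: X_def field_simps)
    finally show ?thesis .
  next
    case False
    \<comment> \<open>Rounding down loses less than a factor 3, hence \<open>X / 3\<close> in the
      estimates below.\<close>
    define d where "d = nat \<lfloor>log 3 X\<rfloor>"
    have d: "real d \<le> log 3 X" "log 3 X < real d + 1"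
      using False X by (auto simp: d_def of_nat_nat)
    have dX: "3 ^ d \<le> X" "X < 3 * 3 ^ d"
    proof -
      have "3 powr real d \<le> 3 powr (log 3 X)" using d(1) by (intro powr_mono) auto
      thus "3 ^ d \<le> X" using X by (simp add: powr_realpow)
      have "3 powr (log 3 X) < 3 powr (real d + 1)" using d(2) by (intro powr_less_mono) auto
      thus "X < 3 * 3 ^ d" using X by (simp add: powr_realpow powr_add mult.commute)
    qed
    define D where "D = (MAX x\<in>A. card {y. (x, y) \<in> zero_sum_pairs A})"
    have D: "card {y. (x, y) \<in> zero_sum_pairs A} \<le> D" if "x \<in> A" for x
      using that finA by (auto simp: D_def)
    have "D \<in> (\<lambda>x. card {y. (x, y) \<in> zero_sum_pairs A}) ` A"
      unfolding D_def using finA A(2) by (intro Max_in) auto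
    then obtain x where x: "x \<in> A" "D = card {y. (x, y) \<in> zero_sum_pairs A}" by blast
    have "real D * card A \<le> s * card (zero_sum_pairs A)" using deg[OF x(1)] x(2) by simp
    hence "real D \<le> s * card (zero_sum_pairs A) / card A" using cA by (simp add: field_simps)
    also have "\<dots> = s * \<delta> / \<alpha> * N"
      using N by (simp add: \<delta>_def \<alpha>_def field_simps power2_eq_square)
    finally have "6 * 3 ^ d * real D \<le> 6 * X * (s * \<delta> / \<alpha> * N)"
      using dX X by (intro mult_mono) auto
    also have "\<dots> = N" using \<alpha> \<delta> s by (simp add: X_def)
    finally have "real (6 * 3 ^ d * D) \<le> real (3 ^ n)" by (simp add: N_def)
    hence "6 * 3 ^ d * D \<le> 3 ^ n" by (simp only: of_nat_le_iff)
    from sampling_bound[OF card3 A(1) D this]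
    have "9 ^ d * card (zero_sum_pairs A) \<le> 6 * card (low_exponents d) * (3 ^ n)\<^sup>2" .
    hence "real (9 ^ d * card (zero_sum_pairs A)) \<le> real (6 * card (low_exponents d) * (3 ^ n)\<^sup>2)"
      by (simp only: of_nat_le_iff)
    hence "9 ^ d * real (card (zero_sum_pairs A)) \<le> 6 * real (card (low_exponents d)) * N\<^sup>2"
      by (simp add: N_def)
    also have "\<dots> \<le> 6 * fp_gamma ^ d * N\<^sup>2"
      using card_low_exponents_le_gamma[of d] by (intro mult_mono) auto
    finally have "9 ^ d * \<delta> \<le> 6 * fp_gamma ^ d" using N by (simp add: \<delta>_def field_simps)
    also have "fp_gamma ^ d = 3 ^ d * (3 ^ d) powr (- \<kappa>)"
    proof -
      have "fp_gamma ^ d = fp_gamma powr d" using fp_gamma_bounds by (simp add: powr_realpow)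
      also have "\<dots> = 3 powr (log 3 fp_gamma * d)"
        by (subst C0_facts(4)) (simp add: powr_powr)
      also have "log 3 fp_gamma * d = real d + real d * (- \<kappa>)" by (simp add: \<kappa>_def algebra_simps)
      finally have "fp_gamma ^ d = 3 powr real d * (3 powr real d) powr (- \<kappa>)"
        by (simp only: powr_add powr_powr)
      thus ?thesis by (simp add: powr_realpow)
    qed
    finally have "3 ^ d * (3 ^ d * \<delta>) \<le> 3 ^ d * (6 * (3 ^ d) powr (- \<kappa>))"
      by (simp add: mult_ac flip: power_mult_distrib)
    hence "3 ^ d * \<delta> \<le> 6 * (3 ^ d) powr (- \<kappa>)" by simp
    also have "\<dots> \<le> 6 * (X / 3) powr (- \<kappa>)"
      using dX X \<kappa> by (intro mult_left_mono powr_mono2') auto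
    finally have le: "3 ^ d * \<delta> \<le> 6 * (X / 3) powr (- \<kappa>)" .
    have "X / 3 * \<delta> \<le> 3 ^ d * \<delta>" using dX(2) \<delta> by (intro mult_right_mono) auto
    hence "X / 3 * \<delta> \<le> 6 * (X / 3) powr (- \<kappa>)" using le by (rule order_trans)
    hence "X / 3 * \<delta> * (X / 3) powr \<kappa> \<le> 6"
      using X by (simp add: powr_minus divide_simps)
    \<comment> \<open>Here \<open>X / 3 * \<delta>\<close> equals
      \<open>\<alpha> / (18 * s)\<close>, and 108 is \<open>6 * 18\<close>.\<close>
    hence "(X / 3) powr \<kappa> \<le> 108 * s / \<alpha>"
      using X s \<alpha> \<delta> by (simp add: X_def field_simps)
    hence "((X / 3) powr \<kappa>) powr (1 / \<kappa>) \<le> (108 * s / \<alpha>) powr (1 / \<kappa>)"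
      using \<kappa> by (intro powr_mono2) auto
    hence X3: "X / 3 \<le> (108 * s / \<alpha>) powr (1 / \<kappa>)"
      using \<kappa> X by (simp add: powr_powr)
    have "1 / (18 * s) * (1 / (108 * s)) powr (1 / \<kappa>) * \<alpha> powr (1 + 1 / \<kappa>)
        = \<alpha> / (18 * s) * ((1 / (108 * s)) powr (1 / \<kappa>) * \<alpha> powr (1 / \<kappa>))"
      using \<alpha> by (simp add: powr_add)
    also have "(1 / (108 * s)) powr (1 / \<kappa>) * \<alpha> powr (1 / \<kappa>) = (inverse (108 * s / \<alpha>)) powr (1 / \<kappa>)"
      using \<alpha> s by (subst powr_mult[symmetric]) (auto simp: field_simps)
    also have "\<dots> = inverse ((108 * s / \<alpha>) powr (1 / \<kappa>))"
      by (rule inverse_powr)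
    also have "\<alpha> / (18 * s) * \<dots> \<le> \<alpha> / (18 * s) * inverse (X / 3)"
      using X3 X \<alpha> s by (intro mult_left_mono le_imp_inverse_le) auto
    also have "\<dots> = \<delta>" using X \<alpha> s \<delta> by (simp add: X_def field_simps)
    finally show ?thesis .
  qed
  hence "1 / (18 * s) * (1 / (108 * s)) powr (1 / \<kappa>) * \<alpha> powr (1 + 1 / \<kappa>) * N\<^sup>2 \<le> \<delta> * N\<^sup>2"
    by (intro mult_right_mono) auto
  also have "\<delta> * N\<^sup>2 = card (zero_sum_pairs A)" using N by (simp add: \<delta>_def)
  finally show ?thesis unfolding \<kappa>(2) \<alpha>_def N_def \<kappa>(3)[symmetric] by simp
qed

lemma zero_sum_pairs_remove:
  assumes "finite A" "x \<in> A"
  shows "card (zero_sum_pairs (A - {x})) + card {y. (x, y) \<in> zero_sum_pairs A} \<le> card (zero_sum_pairs A)"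
proof -
  let ?R = "Pair x ` {y. (x, y) \<in> zero_sum_pairs A}"
  have "card {y. (x, y) \<in> zero_sum_pairs A} = card ?R"
    by (rule card_image[symmetric]) (simp add: inj_on_def)
  moreover have "card (zero_sum_pairs (A - {x})) + card ?R = card (zero_sum_pairs (A - {x}) \<union> ?R)"
  proof (rule card_Un_disjoint[symmetric])
    show "finite (zero_sum_pairs (A - {x}))" using assms(1) by simp
    show "finite ?R"
      using assms(1) by (intro finite_subset[of ?R "zero_sum_pairs A"]) auto
  qed (auto simp: zero_sum_pairs_def)
  moreover have "card (zero_sum_pairs (A - {x}) \<union> ?R) \<le> card (zero_sum_pairs A)"
    using assms(1) by (intro card_mono finite_zero_sum_pairs) (auto simp: zero_sum_pairs_def)
  ultimately show ?thesis by simp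
qed

definition ap_const :: real where
  "ap_const = (let s = real (nat \<lceil>C0\<rceil>) in 1 / (18 * s) * (1 / (108 * s)) powr (C0 - 1))"

lemma ap_const_pos: "0 < ap_const"
proof -
  have "0 < 1 / (18 * s) * (1 / (108 * s)) powr (C0 - 1)" if "0 < s" for s :: real
    using that by simp
  moreover have "0 < nat \<lceil>C0\<rceil>" using C0_facts(3) by linarith
  ultimately show ?thesis unfolding ap_const_def Let_def by (meson of_nat_0_less_iff)
qed

text \<open>The degree hypothesis is met in a subset \<open>B\<close> that minimises the number of
  triples divided by \<open>card B ^ s\<close>, for an integer \<open>s \<ge> C0\<close>. Because
  \<open>s \<ge> C0\<close>, the estimate for \<open>B\<close> carries back to
  \<open>A\<close>.\<close>

lemma zero_sum_pairs_lower_bound: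
  fixes A :: "(nat \<Rightarrow> 'a::{field,finite}) set"
  assumes card3: "CARD('a) = 3" and A: "A \<subseteq> fvec n"
  shows "ap_const * (card A / 3 ^ n) powr C0 * (3 ^ n)\<^sup>2 \<le> card (zero_sum_pairs A)"
proof (cases "A = {}")
  case True
  thus ?thesis by simp
next
  case False
  define s where "s = nat \<lceil>C0\<rceil>"
  have s: "C0 \<le> real s" "1 \<le> s" using C0_facts(3) by (auto simp: s_def) linarith+
  have finA: "finite A" using A finite_fvec finite_subset by blast
  \<comment> \<open>In a minimiser of \<open>f\<close> no point has large degree, since deleting that point would decrease \<open>f\<close>.\<close>
  define f where "f B = card (zero_sum_pairs B) / real (card B) ^ s" for B :: "(nat \<Rightarrow> 'a) set"
  obtain B where B: "B \<in> Pow A - {{}}" "\<And>B'. B' \<in> Pow A - {{}} \<Longrightarrow> f B \<le> f B'"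
    using ex_is_arg_min_if_finite[of "Pow A - {{}}" f] finA False
    unfolding is_arg_min_linorder by blast
  have finB: "finite B" using B(1) finA finite_subset by auto
  have cB: "0 < card B" using B(1) finB by (simp add: card_gt_0_iff)
  have BA: "card B \<le> card A" using B(1) finA by (intro card_mono) auto
  have deg: "card {y. (x, y) \<in> zero_sum_pairs B} * real (card B) \<le> real s * card (zero_sum_pairs B)"
    if x: "x \<in> B" for x
  proof -
    have rem: "real (card (zero_sum_pairs (B - {x}))) + card {y. (x, y) \<in> zero_sum_pairs B}
        \<le> card (zero_sum_pairs B)"
      using zero_sum_pairs_remove[OF finB x] by (simp only: flip: of_nat_add of_nat_le_iff[where 'a = real])
    show ?thesis
    proof (cases "B = {x}")
      \<comment> \<open>Deleting the point of a singleton leaves the empty set, which is outside the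
        minimisation.\<close>
      case True
      hence "card {y. (x, y) \<in> zero_sum_pairs B} * real (card B) \<le> 1 * card (zero_sum_pairs B)"
        using rem by simp
      also have "\<dots> \<le> real (s * card (zero_sum_pairs B))"
        using s(2) by (subst of_nat_le_iff) (intro mult_right_mono; simp)
      finally show ?thesis by simp
    next
      case False
      define b where "b = real (card B)"
      have "card (B - {x}) = card B - 1" using finB x by simp
      hence cBx: "real (card (B - {x})) = b - 1" using cB by (simp add: b_def of_nat_diff)
      have "B - {x} \<in> Pow A - {{}}" using B(1) False x by auto
      hence nz: "0 < card (B - {x})" using finB by (simp add: card_gt_0_iff)
      have b1: "1 < b" using nz cBx by simp
      have "f B \<le> f (B - {x})" by (rule B(2)) fact
      hence "card (zero_sum_pairs B) * (b - 1) ^ s \<le> card (zero_sum_pairs (B - {x})) * b ^ s"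
        using b1 by (simp add: f_def cBx b_def[symmetric] field_simps)
      hence "card (zero_sum_pairs B) * ((b - 1) ^ s / b ^ s) \<le> card (zero_sum_pairs (B - {x}))"
        using b1 by (simp add: field_simps)
      \<comment> \<open>By Bernoulli's inequality, deleting one of \<open>b\<close> points keeps at
        least the proportion \<open>1 - s / b\<close> of \<open>b ^ s\<close>. Minimality then
        leaves at most the proportion \<open>s / b\<close> of the triples to start at that
        point.\<close>
      moreover have "1 - s / b \<le> (b - 1) ^ s / b ^ s"
      proof -
        have "1 + real s * (- (1 / b)) \<le> (1 + - (1 / b)) ^ s"
          using b1 by (intro Bernoulli_inequality) auto
        also have "1 + - (1 / b) = (b - 1) / b" using b1 by (simp add: field_simps)
        finally show ?thesis by (simp add: power_divide)
      qed
      hence "card (zero_sum_pairs B) * (1 - s / b) \<le> card (zero_sum_pairs B) * ((b - 1) ^ s / b ^ s)"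
        by (intro mult_left_mono) auto
      ultimately have "card {y. (x, y) \<in> zero_sum_pairs B} \<le> card (zero_sum_pairs B) * (s / b)"
        using rem by (simp add: algebra_simps)
      thus ?thesis using b1 by (simp add: b_def field_simps)
    qed
  qed
  define N :: real where "N = 3 ^ n"
  have N: "0 < N" by (simp add: N_def)
  define \<beta> where "\<beta> = card B / N"
  define \<rho> where "\<rho> = real (card A) / card B"
  have \<rho>: "1 \<le> \<rho>" using cB BA by (simp add: \<rho>_def)
  have \<beta>: "0 < \<beta>" using cB N by (simp add: \<beta>_def)
  have \<rho>\<beta>: "card A / N = \<rho> * \<beta>" using cB by (simp add: \<rho>_def \<beta>_def)
  have TB: "ap_const * \<beta> powr C0 * N\<^sup>2 \<le> card (zero_sum_pairs B)"
    using bounded_degree_bound[OF card3, of B n "real s"] B(1) A s deg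
    by (auto simp: ap_const_def s_def N_def \<beta>_def Let_def)
  \<comment> \<open>Replacing \<open>\<rho> powr C0\<close> by the larger
    \<open>\<rho> powr s\<close> makes \<open>f B\<close> appear, which minimality bounds by
    \<open>f A\<close>.\<close>
  have "ap_const * (card A / N) powr C0 * N\<^sup>2 = \<rho> powr C0 * (ap_const * \<beta> powr C0 * N\<^sup>2)"
    unfolding \<rho>\<beta> using \<rho> \<beta> by (simp add: powr_mult)
  also have "\<dots> \<le> \<rho> powr s * card (zero_sum_pairs B)"
    using \<rho> s TB ap_const_pos by (intro mult_mono powr_mono) auto
  also have "\<dots> = f B * card A ^ s"
    using \<rho> cB by (simp add: powr_realpow f_def \<rho>_def power_divide)
  also have "\<dots> \<le> f A * card A ^ s"
    using B(2)[of A] False by (intro mult_right_mono) auto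
  also have "\<dots> = card (zero_sum_pairs A)"
    using False finA by (simp add: f_def)
  finally show ?thesis by (simp add: N_def)
qed

section \<open>Density increment and Ramsey bounds\<close>

text \<open>If \<open>y\<close> is \<open>c\<close> times the density, one step makes it at least
  \<open>c\<^sup>2 * (y / c) powr C\<close>, and this is at least \<open>y powr C\<close> as
  \<open>c \<le> 1\<close> and \<open>C \<ge> 2\<close>. So constants do not accumulate.\<close>

lemma density_iteration:
  fixes Inv :: "nat \<Rightarrow> 'x set \<Rightarrow> bool" and N c C b \<alpha> :: real
  assumes N: "0 < N" and c: "0 < c" "c \<le> 1" and C: "2 \<le> C" and \<alpha>: "0 < \<alpha>" "c * \<alpha> \<le> 1"
    and base: "Inv 0 A" "\<alpha> * N \<le> card A"
    and step: "\<And>k A. k < K \<Longrightarrow> Inv k A \<Longrightarrow> b \<le> c * (card A / N) powr C * N \<Longrightarrow>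
      \<exists>A'. Inv (Suc k) A' \<and> c * (card A / N) powr C * N \<le> card A'"
    and large: "b \<le> (c * \<alpha>) powr (C ^ K) * N"
  obtains A' where "Inv K A'" "0 < card A'"
proof -
  have "\<exists>A'. Inv k A' \<and> 1 / c * (c * \<alpha>) powr (C ^ k) * N \<le> card A'" if "k \<le> K" for k
    using that
  proof (induction k)
    case 0
    show ?case using base c \<alpha> by (intro exI[of _ A]) auto
  next
    case (Suc k)
    then obtain B where B: "Inv k B" "1 / c * (c * \<alpha>) powr (C ^ k) * N \<le> card B" by auto
    define \<beta> where "\<beta> = (c * \<alpha>) powr (C ^ Suc k)"
    have "1 / c * \<beta> \<le> c * (card B / N) powr C"
    proof -
      have "1 / c * \<beta> = c * ((1 / c) powr 2 * \<beta>)"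
        using c by (simp add: power2_eq_square field_simps)
      also have "\<dots> \<le> c * ((1 / c) powr C * \<beta>)"
        using c C by (intro mult_left_mono mult_right_mono powr_mono) (auto simp: \<beta>_def)
      also have "(1 / c) powr C * \<beta> = (1 / c * (c * \<alpha>) powr (C ^ k)) powr C"
      proof -
        have mult: "(1 / c * x) powr C = (1 / c) powr C * x powr C" for x
          by (rule powr_mult)
        show ?thesis unfolding \<beta>_def power_Suc2 powr_powr[symmetric] by (rule mult[symmetric])
      qed
      also have "\<dots> \<le> (card B / N) powr C"
        using B(2) N c C by (intro powr_mono2) (auto simp: pos_le_divide_eq)
      finally show ?thesis using c by simp
    qed
    hence le: "1 / c * \<beta> * N \<le> c * (card B / N) powr C * N"
      using N by (intro mult_right_mono) auto
    \<comment> \<open>The lower bounds decrease with \<open>k\<close>, so clearing the threshold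
      \<open>b\<close> at the end clears it at every step.\<close>
    have "b \<le> (c * \<alpha>) powr (C ^ K) * N" by (rule large)
    also have "\<dots> \<le> \<beta> * N"
      unfolding \<beta>_def using N c \<alpha> C Suc.prems
      by (intro mult_right_mono powr_mono' power_increasing) auto
    also have "\<beta> * N \<le> 1 / c * \<beta> * N"
    proof -
      have "1 * \<beta> \<le> 1 / c * \<beta>" using c by (intro mult_right_mono) (auto simp: \<beta>_def)
      thus ?thesis using N by (intro mult_right_mono) auto
    qed
    finally obtain A' where "Inv (Suc k) A'" "c * (card B / N) powr C * N \<le> card A'"
      using step[of k B] B(1) Suc.prems le by (meson Suc_le_lessD order_trans)
    thus ?case using le unfolding \<beta>_def by (meson order_trans)
  qed
  from this[of K] obtain A' where A': "Inv K A'" "1 / c * (c * \<alpha>) powr (C ^ K) * N \<le> card A'"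
    by auto
  have "0 < 1 / c * (c * \<alpha>) powr (C ^ K) * N" using c \<alpha> N by simp
  hence "0 < card A'" using A'(2) by simp
  thus thesis using A'(1) that by blast
qed

text \<open>Elements of \<open>W\<close> contribute at most \<open>w * M\<close> to the sum. The
  rest is spread over at most \<open>N\<close> elements, one of which reaches the average.\<close>

lemma exists_large_avoiding:
  fixes f :: "'x \<Rightarrow> real"
  assumes fin: "finite G" and N: "card G = N" and M: "0 \<le> M" "\<And>d. d \<in> G \<Longrightarrow> f d \<le> M"
    and W: "finite W" "card W \<le> w" and Y: "w * M < Y" "Y \<le> (\<Sum>d\<in>G. f d)"
  obtains d where "d \<in> G" "d \<notin> W" "(Y - w * M) / N \<le> f d"
proof (rule ccontr)
  assume "\<not> thesis"
  hence less: "f d \<le> (Y - w * M) / N \<and> f d \<noteq> (Y - w * M) / N" if "d \<in> G - W" for d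
    using that \<open>\<And>d. d \<in> G \<Longrightarrow> d \<notin> W \<Longrightarrow> (Y - w * M) / N \<le> f d \<Longrightarrow> thesis\<close> by force
  have "(\<Sum>d\<in>G \<inter> W. f d) \<le> (\<Sum>d\<in>G \<inter> W. M)" using M by (intro sum_mono) auto
  also have "\<dots> \<le> w * M"
    using W card_mono[of W "G \<inter> W"] M(1) by (auto intro!: mult_right_mono)
  finally have GW: "(\<Sum>d\<in>G \<inter> W. f d) \<le> w * M" .
  have split: "(\<Sum>d\<in>G. f d) = (\<Sum>d\<in>G \<inter> W. f d) + (\<Sum>d\<in>G - W. f d)"
    using fin by (subst sum.union_disjoint[symmetric]) (auto intro!: sum.cong)
  show False
  proof (cases "G - W = {}")
    case True
    thus ?thesis using split GW Y by (simp only: sum.empty)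
  next
    case False
    have "(\<Sum>d\<in>G - W. f d) < (\<Sum>d\<in>G - W. (Y - w * M) / N)"
      using less fin False by (intro sum_strict_mono) (auto simp: less_le)
    also have "\<dots> = card (G - W) * ((Y - w * M) / N)" by simp
    also have "\<dots> \<le> N * ((Y - w * M) / N)"
      using Y fin N card_mono[of G "G - W"] by (intro mult_right_mono divide_nonneg_nonneg) auto
    also have "\<dots> \<le> Y - w * M" using Y by simp
    finally show ?thesis using split GW Y by linarith
  qed
qed

text \<open>The first hypothesis is the failure of the count in \<open>greedy_blue\<close>. It says
  \<open>q ^ (n - t + 1) \<le> a + 1\<close>, and \<open>q \<ge> 2\<close> absorbs the
  \<open>+ 1\<close>.\<close>

lemma many_red_vectors:
  fixes a q t n :: nat
  assumes "\<not> q ^ (t - 1) * (a + 1) < q ^ n" "2 \<le> q" "1 \<le> t" "t \<le> n"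
  shows "(1 / q) ^ t * q ^ n \<le> real a"
proof -
  have "q ^ n = q ^ (t - 1 + (n - t) + 1)" using assms by simp
  also have "\<dots> = q ^ (t - 1) * (q ^ (n - t) * q)" by (simp only: power_add power_one_right mult.assoc)
  finally have "q ^ (t - 1) * (q ^ (n - t) * q) \<le> q ^ (t - 1) * (a + 1)" using assms(1) by linarith
  moreover have "0 < q ^ (t - 1)" using assms(2) by simp
  ultimately have "q ^ (n - t) * q \<le> a + 1" by (simp only: mult_le_cancel1)
  moreover have "q ^ (n - t) * 2 \<le> q ^ (n - t) * q" using assms(2) by simp
  moreover have "1 \<le> q ^ (n - t)" using assms(2) by simp
  ultimately have "q ^ (n - t) \<le> a" by linarith
  hence "real (q ^ (n - t)) \<le> a" by (simp only: of_nat_le_iff)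
  moreover have "(1 / q) ^ t * real q ^ n = real (q ^ (n - t))"
  proof -
    have "real (q ^ (n - t)) * real q ^ t = real q ^ n" using assms(4) by (simp flip: power_add)
    thus ?thesis using assms(2) by (simp add: power_one_over divide_simps)
  qed
  ultimately show ?thesis by simp
qed

section \<open>Progressions over the field with three elements\<close>

lemma ramsey_prop_3:
  fixes c :: real
  assumes card3: "CARD('a::{field,finite}) = 3" and t: "1 \<le> t" and c: "0 < c" "c \<le> 1" "2 * c \<le> ap_const"
    and large: "3 ^ t \<le> (c * (1 / 3) ^ t) powr (C0 ^ t) * 3 ^ n"
  shows "ramsey_prop TYPE('a) 2 t n"
  unfolding ramsey_prop_def
proof (intro allI, rule disjCI)
  fix col :: "(nat \<Rightarrow> 'a) set \<Rightarrow> bool"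
  assume noblue: "\<not> (\<exists>W. subspace_dim n W t \<and> (\<forall>L. subspace_dim n L 1 \<and> L \<subseteq> W \<longrightarrow> \<not> col L))"
  show "\<exists>W. subspace_dim n W 2 \<and> (\<forall>L. subspace_dim n L 1 \<and> L \<subseteq> W \<longrightarrow> col L)"
  proof (rule ccontr)
    assume nored: "\<not> ?thesis"
    define R where "R = red_vectors col n"
    have nored': "\<And>W. subspace_dim n W 2 \<Longrightarrow> \<exists>L. subspace_dim n L 1 \<and> L \<subseteq> W \<and> \<not> col L"
      using nored by blast
    have meets: "W \<inter> R \<noteq> {}" if "subspace_dim n W t" for W
      using noblue that blueI[of n W t col] unfolding R_def by blast
    have RG: "R \<subseteq> fvec n" "0 \<notin> R" by (auto simp: R_def red_vectors_def)
    have c13: "c * (1 / 3) ^ t \<le> 1" using c by (intro mult_le_one power_le_one) auto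
    have "(3::real) ^ t \<le> 1 * 3 ^ n"
      using large c c13 C0_facts(3) by (intro order_trans[OF large] mult_right_mono powr_le1) auto
    hence tn: "t \<le> n" by simp
    have "\<not> CARD('a) ^ (t - 1) * (card R + 1) < CARD('a) ^ n"
      using greedy_blue[of t col n t] meets unfolding R_def by blast
    from many_red_vectors[OF this _ t tn] have dens: "(1 / 3) ^ t * 3 ^ n \<le> real (card R)"
      by (simp add: card3)
    \<comment> \<open>All cosets \<open>x + W\<close> with \<open>x\<close> in \<open>A\<close> are
      red; \<open>A\<close> shrinks while \<open>W\<close> grows. The size bound on \<open>W\<close>
      limits the directions to be avoided.\<close>
    define Inv where "Inv k A \<longleftrightarrow> A \<subseteq> fvec n \<and> (\<exists>W. subspace_dim n W k \<and> card W \<le> 3 ^ k \<and>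
        (\<forall>x\<in>A. \<forall>w\<in>W. x + w \<in> R))" for k and A :: "(nat \<Rightarrow> 'a) set"
    have base: "Inv 0 R"
      unfolding Inv_def using subspace_dim_zero RG by (intro conjI exI[of _ "{0}"]) auto
    have step: "\<exists>A'. Inv (Suc k) A' \<and> c * (card A / 3 ^ n) powr C0 * 3 ^ n \<le> card A'"
      if k: "k < t" and inv: "Inv k A" and b: "3 ^ t \<le> c * (card A / 3 ^ n) powr C0 * 3 ^ n" for k A
    proof -
      obtain W where W: "subspace_dim n W k" "card W \<le> 3 ^ k" "\<And>x w. x \<in> A \<Longrightarrow> w \<in> W \<Longrightarrow> x + w \<in> R"
        using inv by (auto simp: Inv_def)
      have AG: "A \<subseteq> fvec n" using inv by (simp add: Inv_def)
      have finA: "finite A" using AG finite_fvec finite_subset by blast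
      have WG: "W \<subseteq> fvec n" using W(1) by (auto simp: subspace_dim_def is_subspace_def)
      have finW: "finite W" using WG finite_fvec finite_subset by blast
      define G where "G = (fvec n :: (nat \<Rightarrow> 'a) set)"
      have G: "finite G" "card G = 3 ^ n" by (simp_all add: G_def card_fvec card3)
      \<comment> \<open>As 0, 1 and -1 are all the scalars, these are the points whose coset of the
        line of \<open>d\<close> lies in \<open>A\<close>.\<close>
      define Ad where "Ad d = {x \<in> A. x + d \<in> A \<and> x - d \<in> A}" for d
      have finAd: "finite (Ad d)" for d using finA by (simp add: Ad_def)
      have two: "2 * u = - u" for u :: "nat \<Rightarrow> 'a"
      proof
        fix i
        have "2 * u i = (1 + 1) * u i" by simp
        thus "(2 * u) i = (- u) i" unfolding CARD_3_UNIV(2)[OF card3] by simp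
      qed
      \<comment> \<open>The triple \<open>x, y, - x - y\<close> is the progression
        \<open>x, x + d, x - d\<close> with \<open>d = y - x\<close>.\<close>
      have "card (zero_sum_pairs A) \<le> card (SIGMA d:G. Ad d)"
      proof (rule card_inj_on_le[of "\<lambda>(x, y). (y - x, x)"])
        show "inj_on (\<lambda>(x, y). (y - x, x)) (zero_sum_pairs A)" by (auto simp: inj_on_def)
        show "finite (SIGMA d:G. Ad d)" using G finAd by auto
        show "(\<lambda>(x, y). (y - x, x)) ` zero_sum_pairs A \<subseteq> (SIGMA d:G. Ad d)"
        proof (clarify)
          fix x y assume xy: "(x, y) \<in> zero_sum_pairs A"
          have "x - (y - x) = 2 * x - y" by simp
          also have "\<dots> = - x - y" by (simp only: two)
          finally have "x - (y - x) = - x - y" .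
          moreover have "x + (y - x) = y" by simp
          moreover have "x \<in> A" "y \<in> A" "- x - y \<in> A"
            using xy by (simp_all add: zero_sum_pairs_def)
          ultimately have "x \<in> Ad (y - x)"
            unfolding Ad_def mem_Collect_eq by (simp only:)
          moreover have "y - x \<in> G"
            unfolding G_def using \<open>x \<in> A\<close> \<open>y \<in> A\<close> AG by (intro fvec_closed) auto
          ultimately show "y - x \<in> G \<and> x \<in> Ad (y - x)" by blast
        qed
      qed
      also have "\<dots> = (\<Sum>d\<in>G. card (Ad d))" using G finAd by (intro card_SigmaI) auto
      finally have le: "real (card (zero_sum_pairs A)) \<le> (\<Sum>d\<in>G. real (card (Ad d)))"
        by (simp only: flip: of_nat_sum of_nat_le_iff[where 'a = real])
      \<comment> \<open>The sum over \<open>d\<close> is at least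
        \<open>2 * \<theta> * 3 ^ n\<close>. Avoiding \<open>W\<close> costs at most half of it, as
        \<open>3 ^ k \<le> \<theta>\<close>; this is the 2 in
        \<open>2 * c \<le> ap_const\<close>.\<close>
      define \<theta> where "\<theta> = c * (card A / 3 ^ n) powr C0 * 3 ^ n"
      have "2 * \<theta> * 3 ^ n = 2 * c * (card A / 3 ^ n) powr C0 * (3 ^ n)\<^sup>2"
        by (simp add: \<theta>_def power2_eq_square)
      also have "\<dots> \<le> ap_const * (card A / 3 ^ n) powr C0 * (3 ^ n)\<^sup>2"
        using c by (intro mult_right_mono) auto
      also have "\<dots> \<le> card (zero_sum_pairs A)" by (rule zero_sum_pairs_lower_bound[OF card3 AG])
      finally have low: "2 * \<theta> * 3 ^ n \<le> (\<Sum>d\<in>G. real (card (Ad d)))" using le by simp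
      have "(3::real) ^ k \<le> 3 ^ t" using k by (intro power_increasing) auto
      hence "3 ^ k \<le> \<theta>" unfolding \<theta>_def using b by (rule order_trans)
      hence "real (3 ^ k) \<le> \<theta>" by simp
      moreover have "0 < \<theta>" using b by (simp add: \<theta>_def order_less_le_trans[of 0 "3 ^ t"])
      ultimately have "real (3 ^ k) * 3 ^ n < 2 * \<theta> * 3 ^ n" by simp
      moreover have "real (card (Ad d)) \<le> 3 ^ n" for d
      proof -
        have "card (Ad d) \<le> card G" using G AG by (intro card_mono) (auto simp: Ad_def G_def)
        hence "real (card (Ad d)) \<le> real (3 ^ n)" unfolding G(2) by (simp only: of_nat_le_iff)
        thus ?thesis by simp
      qed
      ultimately obtain d where d: "d \<in> G" "d \<notin> W"
        "(2 * \<theta> * 3 ^ n - real (3 ^ k) * 3 ^ n) / real (3 ^ n) \<le> real (card (Ad d))"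
        using exists_large_avoiding[OF G _ _ finW W(2) _ low, of "3 ^ n"] by (metis zero_le_numeral zero_le_power)
      have "\<theta> \<le> 2 * \<theta> - 3 ^ k" using \<open>real (3 ^ k) \<le> \<theta>\<close> by simp
      also have "\<dots> = (2 * \<theta> * 3 ^ n - real (3 ^ k) * 3 ^ n) / real (3 ^ n)"
        by (simp add: field_simps)
      finally have big: "\<theta> \<le> real (card (Ad d))" using d(3) by linarith
      have "Inv (Suc k) (Ad d)"
        unfolding Inv_def
      proof (intro conjI exI[of _ "extend d W"] ballI)
        show "Ad d \<subseteq> fvec n" using AG by (auto simp: Ad_def)
        show "subspace_dim n (extend d W) (Suc k)"
          using d W(1) by (intro subspace_dim_extend) (auto simp: G_def)
        show "card (extend d W) \<le> 3 ^ Suc k"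
          using card_extend[OF finW, of d] W(2) by (simp add: card3)
      next
        fix x w' assume x: "x \<in> Ad d" and "w' \<in> extend d W"
        then obtain w a where w: "w \<in> W" "w' = w + vscale a d" by (auto simp: mem_extend)
        have "a \<in> {0, 1, -1}" unfolding CARD_3_UNIV(1)[OF card3, symmetric] by simp
        hence "vscale a d \<in> {0, d, - d}" by auto
        hence "x + vscale a d \<in> A" using x by (auto simp: Ad_def)
        from W(3)[OF this w(1)] show "x + w' \<in> R" by (simp add: w(2) add_ac)
      qed
      thus ?thesis using big unfolding \<theta>_def by blast
    qed
    obtain A where A: "Inv t A" "0 < card A"
      by (rule density_iteration[where Inv = Inv and N = "3 ^ n" and C = C0 and \<alpha> = "(1 / 3) ^ t",
          OF _ c(1,2) C0_facts(3) _ c13 base dens step large]) auto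
    then obtain x where x: "x \<in> A" by fastforce
    obtain W where W: "subspace_dim n W t" "\<And>w. w \<in> W \<Longrightarrow> x + w \<in> R"
      using A(1) x by (auto simp: Inv_def)
    have sub: "is_subspace n W" using W(1) by (simp add: subspace_dim_def)
    \<comment> \<open>\<open>W\<close> is not blue, so it contains a red \<open>v\<close>. The coset
      of its line through \<open>x\<close> is red, whereas \<open>no_red_plane\<close> yields a
      vector outside \<open>R\<close> on it.\<close>
    obtain v where v: "v \<in> W" "v \<in> R" using meets[OF W(1)] by blast
    have vW: "vscale a v \<in> W" for a using sub v(1) by (simp add: is_subspace_iff)
    \<comment> \<open>Otherwise 0 would lie in \<open>x + W\<close> and hence in
      \<open>R\<close>.\<close>
    have "x \<notin> line v"
    proof
      assume "x \<in> line v"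
      then obtain a where a: "x = vscale a v" unfolding line_def by blast
      have "x + vscale (- a) v = 0" unfolding a by (auto simp: fun_eq_iff)
      thus False using W(2)[OF vW, of "- a"] RG(2) by simp
    qed
    moreover have "x \<in> fvec n" using A(1) x by (auto simp: Inv_def)
    ultimately obtain a where "x + vscale a v \<notin> R"
      using no_red_plane[of n col v x, OF nored'] v(2) unfolding R_def by blast
    thus False using W(2)[OF vW] by blast
  qed
qed

section \<open>Six-point configurations over the field with two elements\<close>

lemma CARD_2_UNIV:
  assumes "CARD('a::{field,finite}) = 2"
  shows "(UNIV :: 'a set) = {0, 1}" and "(1::'a) + 1 = 0"
proof -
  have "card {0, 1 :: 'a} = CARD('a)" using assms by simp
  thus U: "(UNIV :: 'a set) = {0, 1}" by (metis card_subset_eq finite subset_UNIV)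
  have "(1::'a) + 1 \<in> {0, 1}" using U by blast
  moreover have "(1::'a) + 1 \<noteq> 1" by (simp only: add_cancel_left_left one_neq_zero not_False_eq_True)
  ultimately show "(1::'a) + 1 = 0" by blast
qed

lemma char_2_add_self:
  fixes u v :: "nat \<Rightarrow> 'a::{field,finite}"
  assumes "CARD('a) = 2"
  shows "u + u = 0" and "u + (u + v) = v" and "- u = u"
proof -
  have "u i + u i = 0" for i
    using CARD_2_UNIV(2)[OF assms] distrib_left[of "u i" 1 1] by simp
  thus 1: "u + u = 0" by (simp add: fun_eq_iff)
  show "u + (u + v) = v" using 1 by (simp flip: add.assoc)
  show "- u = u" using 1 by (metis minus_unique)
qed

text \<open>The points \<open>0, d\<^sub>1, \<dots>, d\<^sub>4, d\<^sub>1 + \<dots> + d\<^sub>4\<close>: their pairwise sums exhaust the span of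
  \<open>d\<^sub>1, \<dots>, d\<^sub>4\<close>, and six vectors form a translate of such a set iff they sum to zero.\<close>

definition six_points :: "(nat \<Rightarrow> 'a::field) \<Rightarrow> (nat \<Rightarrow> 'a) \<Rightarrow> (nat \<Rightarrow> 'a) \<Rightarrow> (nat \<Rightarrow> 'a) \<Rightarrow> (nat \<Rightarrow> 'a) set" where
  "six_points d1 d2 d3 d4 = {0, d1, d2, d3, d4, d1 + (d2 + (d3 + d4))}"

definition six_core :: "(nat \<Rightarrow> 'a::field) set \<Rightarrow> (nat \<Rightarrow> 'a) \<Rightarrow> (nat \<Rightarrow> 'a) \<Rightarrow> (nat \<Rightarrow> 'a) \<Rightarrow> (nat \<Rightarrow> 'a) \<Rightarrow> (nat \<Rightarrow> 'a) set" where
  "six_core A d1 d2 d3 d4 = {x \<in> A. \<forall>b\<in>six_points d1 d2 d3 d4. x + b \<in> A}"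

lemma six_points_sums:
  fixes d1 d2 d3 d4 :: "nat \<Rightarrow> 'a::{field,finite}"
  assumes card2: "CARD('a) = 2"
  obtains b b' where "b \<in> six_points d1 d2 d3 d4" "b' \<in> six_points d1 d2 d3 d4"
    "vscale c1 d1 + vscale c2 d2 + vscale c3 d3 + vscale c4 d4 = b + b'"
proof -
  define U where "U = {u. \<exists>b\<in>six_points d1 d2 d3 d4. \<exists>b'\<in>six_points d1 d2 d3 d4. u = b + b'}"
  have U: "u \<in> U" if "b \<in> six_points d1 d2 d3 d4" "b' \<in> six_points d1 d2 d3 d4" "u = b + b'" for u b b'
    using that by (auto simp: U_def)
  note xor = char_2_add_self[OF card2] add.commute[where 'a = "nat \<Rightarrow> 'a"]
    add.left_commute[where 'a = "nat \<Rightarrow> 'a"]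
  have six: "0 \<in> six_points d1 d2 d3 d4" "d1 \<in> six_points d1 d2 d3 d4" "d2 \<in> six_points d1 d2 d3 d4"
    "d3 \<in> six_points d1 d2 d3 d4" "d4 \<in> six_points d1 d2 d3 d4"
    "d1 + (d2 + (d3 + d4)) \<in> six_points d1 d2 d3 d4"
    by (auto simp: six_points_def)
  \<comment> \<open>A sum of three directions is the sixth point plus the remaining direction; the
    other cases are immediate.\<close>
  have span: "0 \<in> U" "d1 \<in> U" "d2 \<in> U" "d3 \<in> U" "d4 \<in> U"
    "d1 + d2 \<in> U" "d1 + d3 \<in> U" "d1 + d4 \<in> U" "d2 + d3 \<in> U" "d2 + d4 \<in> U" "d3 + d4 \<in> U"
    "d1 + d2 + d3 \<in> U" "d1 + d2 + d4 \<in> U" "d1 + d3 + d4 \<in> U" "d2 + d3 + d4 \<in> U"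
    "d1 + d2 + d3 + d4 \<in> U"
    by (rule U[OF six(1) six(1)] U[OF six(1) six(2)] U[OF six(1) six(3)] U[OF six(1) six(4)]
        U[OF six(1) six(5)] U[OF six(2) six(3)] U[OF six(2) six(4)] U[OF six(2) six(5)]
        U[OF six(3) six(4)] U[OF six(3) six(5)] U[OF six(4) six(5)]
        U[OF six(5) six(6)] U[OF six(4) six(6)] U[OF six(3) six(6)] U[OF six(2) six(6)]
        U[OF six(1) six(6)]; simp add: xor; fail)+
  have c01: "c1 \<in> {0, 1}" "c2 \<in> {0, 1}" "c3 \<in> {0, 1}" "c4 \<in> {0, 1}"
    unfolding CARD_2_UNIV(1)[OF card2, symmetric] by simp_all
  have "vscale c1 d1 + vscale c2 d2 + vscale c3 d3 + vscale c4 d4 \<in> U"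
    using c01 span by (elim insertE emptyE) (simp_all only: vscale_simps add_0_left add_0_right)
  thus thesis using that by (auto simp: U_def)
qed

text \<open>Cauchy-Schwarz for the number of representations as a sum of three elements of
  \<open>A\<close> gives many solutions of \<open>a + b + c = a' + b' + c'\<close>. Each yields a
  base point \<open>a\<close> with directions \<open>b + a\<close>, \<open>c + a\<close>,
  \<open>a' + a\<close>, \<open>b' + a\<close>; the sixth point is \<open>c'\<close>.\<close>

lemma six_core_count:
  fixes A :: "(nat \<Rightarrow> 'a::{field,finite}) set"
  assumes card2: "CARD('a) = 2" and A: "A \<subseteq> fvec n"
  defines "G \<equiv> fvec n"
  shows "real (card A) ^ 6 / 2 ^ n
    \<le> (\<Sum>d1\<in>G. \<Sum>d2\<in>G. \<Sum>d3\<in>G. \<Sum>d4\<in>G. real (card (six_core A d1 d2 d3 d4)))"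
proof -
  note xor = char_2_add_self[OF card2] add.commute[where 'a = "nat \<Rightarrow> 'a"]
    add.left_commute[where 'a = "nat \<Rightarrow> 'a"]
  have G: "finite G" "card G = 2 ^ n" by (simp_all add: G_def card_fvec card2)
  have finA: "finite A" using A finite_fvec finite_subset by blast
  define R where "R g = {z \<in> A \<times> A \<times> A. fst z + fst (snd z) + snd (snd z) = g}" for g
  have finR: "finite (R g)" for g using finA by (simp add: R_def)
  have "card (A \<times> A \<times> A) = (\<Sum>g\<in>G. card (R g))"
  proof -
    have "A \<times> A \<times> A = (\<Union>g\<in>G. R g)" using A by (auto simp: R_def G_def subset_iff)
    also have "card \<dots> = (\<Sum>g\<in>G. card (R g))"
      using G finR by (intro card_UN_disjoint) (auto simp: R_def)
    finally show ?thesis .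
  qed
  hence "card A ^ 3 = (\<Sum>g\<in>G. card (R g))"
    by (simp add: card_cartesian_product power3_eq_cube)
  hence sumR: "real (card A) ^ 3 = (\<Sum>g\<in>G. real (card (R g)))"
    by (metis of_nat_power of_nat_sum)
  have "real (card A) ^ 6 = (\<Sum>g\<in>G. real (card (R g)))\<^sup>2"
    unfolding sumR[symmetric] by (simp flip: power_mult)
  also have "\<dots> \<le> 2 ^ n * (\<Sum>g\<in>G. (real (card (R g)))\<^sup>2)"
    using sum_squared_le_sum_of_squares[of "\<lambda>g. real (card (R g))" G] G by (simp add: mult.commute)
  also have "(\<Sum>g\<in>G. (real (card (R g)))\<^sup>2) = real (card (SIGMA g:G. R g \<times> R g))"
    using G finR by (subst card_SigmaI) (auto simp: card_cartesian_product power2_eq_square)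
  also have "card (SIGMA g:G. R g \<times> R g)
      \<le> card (SIGMA D:G \<times> G \<times> G \<times> G. six_core A (fst D) (fst (snd D)) (fst (snd (snd D))) (snd (snd (snd D))))"
  proof (rule card_inj_on_le)
    let ?f = "\<lambda>(g :: nat \<Rightarrow> 'a, (a, b, c), (a', b', c' :: nat \<Rightarrow> 'a)). ((b + a, c + a, a' + a, b' + a), a)"
    show "inj_on ?f (SIGMA g:G. R g \<times> R g)"
      by (rule inj_onI) (auto simp: R_def, metis add_left_cancel)
    show "?f ` (SIGMA g:G. R g \<times> R g)
        \<subseteq> (SIGMA D:G \<times> G \<times> G \<times> G. six_core A (fst D) (fst (snd D)) (fst (snd (snd D))) (snd (snd (snd D))))"
    proof (rule image_subsetI)
      fix z assume z: "z \<in> (SIGMA g:G. R g \<times> R g)"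
      then obtain g a b c a' b' c' where z': "z = (g, (a, b, c), (a', b', c'))" by (cases z) auto
      have mem: "a \<in> A" "b \<in> A" "c \<in> A" "a' \<in> A" "b' \<in> A" "c' \<in> A" "a + b + c = a' + b' + c'"
        using z by (auto simp: R_def z')
      have "a + (b + a + (c + a + (a' + a + (b' + a)))) = a' + b' + (a + b + c)"
        by (simp add: xor)
      also have "\<dots> = c'" unfolding mem(7) by (simp add: xor)
      finally have "a \<in> six_core A (b + a) (c + a) (a' + a) (b' + a)"
        using mem(1-6) unfolding six_core_def six_points_def by (simp add: xor)
      moreover have "b + a \<in> G" "c + a \<in> G" "a' + a \<in> G" "b' + a \<in> G"
        using mem(1-6) A unfolding G_def by (auto intro!: fvec_closed)
      ultimately show "?f z \<in> (SIGMA D:G \<times> G \<times> G \<times> G. six_core A (fst D) (fst (snd D)) (fst (snd (snd D))) (snd (snd (snd D))))"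
        by (simp add: z')
    qed
    show "finite (SIGMA D:G \<times> G \<times> G \<times> G. six_core A (fst D) (fst (snd D)) (fst (snd (snd D))) (snd (snd (snd D))))"
      using G finA by (intro finite_SigmaI finite_cartesian_product) (auto simp: six_core_def)
  qed
  also have "\<dots> = (\<Sum>D\<in>G \<times> G \<times> G \<times> G. card (six_core A (fst D) (fst (snd D)) (fst (snd (snd D))) (snd (snd (snd D)))))"
    using G finA by (intro card_SigmaI finite_cartesian_product) (auto simp: six_core_def)
  also have "\<dots> = (\<Sum>d1\<in>G. \<Sum>d2\<in>G. \<Sum>d3\<in>G. \<Sum>d4\<in>G. card (six_core A d1 d2 d3 d4))"
    by (simp add: sum.cartesian_product split_beta)
  finally have "real (card A) ^ 6 \<le> 2 ^ n * real (\<Sum>d1\<in>G. \<Sum>d2\<in>G. \<Sum>d3\<in>G. \<Sum>d4\<in>G. card (six_core A d1 d2 d3 d4))"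
    by simp
  thus ?thesis by (simp add: field_simps)
qed

text \<open>Directions are chosen one by one, averaging over the remaining ones. The spans to avoid
  have at most \<open>w\<close>, \<open>2 * w\<close>, \<open>4 * w\<close>, \<open>8 * w\<close>
  elements, a total loss of \<open>15 * w\<close>, which is less than half of the average.\<close>

lemma exists_six_core:
  fixes A W :: "(nat \<Rightarrow> 'a::{field,finite}) set"
  assumes card2: "CARD('a) = 2" and A: "A \<subseteq> fvec n" and W: "finite W" "card W \<le> w"
    and dens: "32 * real w \<le> (card A / 2 ^ n) ^ 6 * 2 ^ n" "1 \<le> w"
  obtains d1 d2 d3 d4 where
    "d1 \<in> fvec n" "d1 \<notin> W" "d2 \<in> fvec n" "d2 \<notin> extend d1 W"
    "d3 \<in> fvec n" "d3 \<notin> extend d2 (extend d1 W)"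
    "d4 \<in> fvec n" "d4 \<notin> extend d3 (extend d2 (extend d1 W))"
    "1 / 2 * (card A / 2 ^ n) ^ 6 * 2 ^ n \<le> card (six_core A d1 d2 d3 d4)"
proof -
  define G where "G = (fvec n :: (nat \<Rightarrow> 'a) set)"
  define N :: real where "N = 2 ^ n"
  have N: "0 < N" by (simp add: N_def)
  have G: "finite G" "card G = 2 ^ n" by (simp_all add: G_def card_fvec card2)
  \<comment> \<open>By \<open>six_core_count\<close>, a lower bound for the average size of
    \<open>six_core\<close> over all choices of directions.\<close>
  define Y where "Y = (card A / N) ^ 6 * N"
  have Yw: "32 * real w \<le> Y" "1 \<le> real w" using dens by (auto simp: Y_def N_def)
  have finE: "finite (extend d U)" and cE: "card (extend d U) \<le> 2 * m"
    if "finite U" "card U \<le> m" for d and U :: "(nat \<Rightarrow> 'a) set" and m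
  proof -
    show "finite (extend d U)" using that by (simp add: extend_def)
    show "card (extend d U) \<le> 2 * m" using card_extend[OF that(1), of d] that(2) card2 by simp
  qed
  have bound: "card (six_core A d1 d2 d3 d4) \<le> N" for d1 d2 d3 d4
  proof -
    have "card (six_core A d1 d2 d3 d4) \<le> card G"
      using G A by (intro card_mono) (auto simp: six_core_def G_def)
    thus ?thesis unfolding G(2) N_def by (metis of_nat_le_iff of_nat_numeral of_nat_power)
  qed
  have sumb: "(\<Sum>d\<in>G. f d) \<le> N * M" if "\<And>d. f d \<le> M" for f :: "(nat \<Rightarrow> 'a) \<Rightarrow> real" and M
    using sum_bounded_above[of G f M] that G by (simp add: N_def)
  \<comment> \<open>\<open>f3\<close>, \<open>f2\<close> and \<open>f1\<close> sum over the
    directions not yet chosen.\<close>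
  define f4 where "f4 d1 d2 d3 d4 = real (card (six_core A d1 d2 d3 d4))" for d1 d2 d3 d4
  define f3 where "f3 d1 d2 d3 = (\<Sum>d4\<in>G. f4 d1 d2 d3 d4)" for d1 d2 d3
  define f2 where "f2 d1 d2 = (\<Sum>d3\<in>G. f3 d1 d2 d3)" for d1 d2
  define f1 where "f1 d1 = (\<Sum>d2\<in>G. f2 d1 d2)" for d1
  have b4: "f4 d1 d2 d3 d4 \<le> N" for d1 d2 d3 d4 using bound by (simp add: f4_def)
  have b3: "f3 d1 d2 d3 \<le> N * N" for d1 d2 d3 unfolding f3_def by (rule sumb[OF b4])
  have b2: "f2 d1 d2 \<le> N * (N * N)" for d1 d2 unfolding f2_def by (rule sumb[OF b3])
  have b1: "f1 d1 \<le> N * (N * (N * N))" for d1 unfolding f1_def by (rule sumb[OF b2])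
  have NN: "real (2 ^ n) = N" by (simp add: N_def)
  \<comment> \<open>\<open>Z\<close> is the normalised average before a direction is chosen;
    avoiding \<open>U\<close> lowers it by at most \<open>m\<close>.\<close>
  have avoid: "\<exists>d\<in>G. d \<notin> U \<and> (Z - m) * M \<le> f d"
    if U: "finite U" "card U \<le> m" and M: "\<And>d. f d \<le> N * M" "0 < M" and Z: "m < Z"
      "Z * (N * M) \<le> (\<Sum>d\<in>G. f d)"
    for f :: "(nat \<Rightarrow> 'a) \<Rightarrow> real" and U and m :: nat and Z M :: real
  proof -
    have "m * (N * M) < Z * (N * M)" using Z N M(2) by (intro mult_strict_right_mono) auto
    then obtain d where "d \<in> G" "d \<notin> U" "(Z * (N * M) - m * (N * M)) / real (2 ^ n) \<le> f d"
      using exists_large_avoiding[OF G _ M(1) U _ Z(2)] N M(2) by (metis less_imp_le mult_pos_pos)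
    moreover have "(Z * (N * M) - m * (N * M)) / real (2 ^ n) = (Z - m) * M"
      unfolding NN using N by (simp add: field_simps)
    ultimately show ?thesis by auto
  qed
  have "Y * (N * (N * (N * N))) \<le> (\<Sum>d\<in>G. f1 d)"
  proof -
    have "Y * (N * (N * (N * N))) = real (card A) ^ 6 / 2 ^ n"
      using N unfolding Y_def N_def[symmetric] by (simp add: power_divide power_numeral_reduce)
    also have "\<dots> \<le> (\<Sum>d\<in>G. f1 d)"
      using six_core_count[OF card2 A] by (simp add: f1_def f2_def f3_def f4_def G_def)
    finally show ?thesis .
  qed
  then obtain d1 where d1: "d1 \<in> G" "d1 \<notin> W" "(Y - w) * (N * (N * N)) \<le> f1 d1"
    using avoid[OF W, where f = f1 and M = "N * (N * N)" and Z = Y] b1 N Yw by auto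
  have W1: "finite (extend d1 W)" "card (extend d1 W) \<le> 2 * w" by (rule finE[OF W], rule cE[OF W])
  obtain d2 where d2: "d2 \<in> G" "d2 \<notin> extend d1 W" "(Y - w - real (2 * w)) * (N * N) \<le> f2 d1 d2"
    using avoid[OF W1, where f = "f2 d1" and M = "N * N" and Z = "Y - w"] b2 N Yw d1(3) by (auto simp: f1_def)
  have W2: "finite (extend d2 (extend d1 W))" "card (extend d2 (extend d1 W)) \<le> 2 * (2 * w)"
    by (rule finE[OF W1], rule cE[OF W1])
  obtain d3 where d3: "d3 \<in> G" "d3 \<notin> extend d2 (extend d1 W)"
      "(Y - w - real (2 * w) - real (2 * (2 * w))) * N \<le> f3 d1 d2 d3"
    using avoid[OF W2, where f = "f3 d1 d2" and M = N and Z = "Y - w - real (2 * w)"] b3 N Yw d2(3) by (auto simp: f2_def)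
  have W3: "finite (extend d3 (extend d2 (extend d1 W)))"
      "card (extend d3 (extend d2 (extend d1 W))) \<le> 2 * (2 * (2 * w))"
    by (rule finE[OF W2], rule cE[OF W2])
  have b4': "f4 d1 d2 d3 d \<le> N * 1" for d using b4 by simp
  obtain d4 where d4: "d4 \<in> G" "d4 \<notin> extend d3 (extend d2 (extend d1 W))"
      "(Y - w - real (2 * w) - real (2 * (2 * w)) - real (2 * (2 * (2 * w)))) * 1 \<le> f4 d1 d2 d3 d4"
    using avoid[OF W3, where f = "f4 d1 d2 d3" and M = 1 and Z = "Y - w - real (2 * w) - real (2 * (2 * w))"] b4' N Yw d3(3)
    by (auto simp: f3_def)
  have "1 / 2 * Y \<le> real (card (six_core A d1 d2 d3 d4))"
    using d4(3) Yw by (simp add: f4_def)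
  thus thesis using d1 d2 d3 d4 that[of d1 d2 d3 d4] by (simp add: Y_def N_def G_def)
qed

text \<open>Only the translates \<open>x + P\<close> are red here, where each element of
  \<open>W\<close> is a sum of two elements of \<open>P\<close>. A red \<open>v = p + p'\<close> in
  \<open>W\<close> yields the red plane with nonzero vectors \<open>v\<close>, \<open>x + p\<close>,
  \<open>x + p'\<close>. \<open>K\<close> counts steps of four dimensions each.\<close>

lemma ramsey_prop_2:
  assumes card2: "CARD('a::{field,finite}) = 2" and t: "1 \<le> t" "t \<le> 4 * K"
    and large: "2 ^ (4 * K + 4) \<le> (1 / 2 * (1 / 2) ^ t :: real) powr (6 ^ K) * 2 ^ n"
  shows "ramsey_prop TYPE('a) 2 t n"
  unfolding ramsey_prop_def
proof (intro allI, rule disjCI)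
  fix col :: "(nat \<Rightarrow> 'a) set \<Rightarrow> bool"
  assume noblue: "\<not> (\<exists>W. subspace_dim n W t \<and> (\<forall>L. subspace_dim n L 1 \<and> L \<subseteq> W \<longrightarrow> \<not> col L))"
  show "\<exists>W. subspace_dim n W 2 \<and> (\<forall>L. subspace_dim n L 1 \<and> L \<subseteq> W \<longrightarrow> col L)"
  proof (rule ccontr)
    assume nored: "\<not> ?thesis"
    note xor = char_2_add_self[OF card2] add.commute[where 'a = "nat \<Rightarrow> 'a"]
      add.left_commute[where 'a = "nat \<Rightarrow> 'a"]
    define R where "R = red_vectors col n"
    have nored': "\<And>W. subspace_dim n W 2 \<Longrightarrow> \<exists>L. subspace_dim n L 1 \<and> L \<subseteq> W \<and> \<not> col L"
      using nored by blast
    have meets: "W \<inter> R \<noteq> {}" if "subspace_dim n W t" for W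
      using noblue that blueI[of n W t col] unfolding R_def by blast
    have RG: "R \<subseteq> fvec n" "0 \<notin> R" by (auto simp: R_def red_vectors_def)
    have c12: "1 / 2 * (1 / 2 :: real) ^ t \<le> 1" by (intro mult_le_one power_le_one) auto
    have "(2::real) ^ (4 * K + 4) \<le> 1 * 2 ^ n"
      using c12 by (intro order_trans[OF large] mult_right_mono powr_le1) auto
    hence tn: "t \<le> n" using t by simp
    have "\<not> CARD('a) ^ (t - 1) * (card R + 1) < CARD('a) ^ n"
      using greedy_blue[of t col n t] meets unfolding R_def by blast
    from many_red_vectors[OF this _ t(1) tn] have dens: "(1 / 2) ^ t * 2 ^ n \<le> real (card R)"
      by (simp add: card2)
    define Inv where "Inv k A \<longleftrightarrow> A \<subseteq> fvec n \<and> (\<exists>W P. subspace_dim n W (4 * k) \<and> card W \<le> 2 ^ (4 * k) \<and>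
        (\<forall>x\<in>A. \<forall>p\<in>P. x + p \<in> R) \<and> (\<forall>w\<in>W. \<exists>p\<in>P. \<exists>p'\<in>P. w = p + p'))"
      for k and A :: "(nat \<Rightarrow> 'a) set"
    have base: "Inv 0 R"
      unfolding Inv_def using subspace_dim_zero RG by (intro conjI exI[of _ "{0}"]) auto
    have step: "\<exists>A'. Inv (Suc k) A' \<and> 1 / 2 * (card A / 2 ^ n) powr 6 * 2 ^ n \<le> card A'"
      if k: "k < K" and inv: "Inv k A" and b: "2 ^ (4 * K + 4) \<le> 1 / 2 * (card A / 2 ^ n) powr 6 * 2 ^ n"
      for k A
    proof -
      have AG: "A \<subseteq> fvec n" using inv by (simp add: Inv_def)
      obtain W P where W: "subspace_dim n W (4 * k)" "card W \<le> 2 ^ (4 * k)"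
        and AP': "\<forall>x\<in>A. \<forall>p\<in>P. x + p \<in> R" and WP': "\<forall>w\<in>W. \<exists>p\<in>P. \<exists>p'\<in>P. w = p + p'"
        using inv unfolding Inv_def by (elim conjE exE)
      note AP = AP'[rule_format] and WP = WP'[rule_format]
      have WG: "W \<subseteq> fvec n" using W(1) by (auto simp: subspace_dim_def is_subspace_def)
      have finW: "finite W" using WG finite_fvec finite_subset by blast
      have b': "2 ^ (4 * K + 4) \<le> 1 / 2 * (card A / 2 ^ n) ^ 6 * 2 ^ n" using b by simp
      have "(2::real) ^ (4 * k) \<le> 2 ^ (4 * K)" using k by (intro power_increasing) auto
      \<comment> \<open>The exponent \<open>4 * K + 4\<close> in the threshold provides the factor
        32 required by \<open>exists_six_core\<close>.\<close>
      moreover have "32 * 2 ^ (4 * K) \<le> (card A / 2 ^ n) ^ 6 * 2 ^ n"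
        using b' by (simp add: power_add)
      ultimately have "32 * 2 ^ (4 * k) \<le> (card A / 2 ^ n) ^ 6 * 2 ^ n" by linarith
      hence "32 * real (2 ^ (4 * k)) \<le> (card A / 2 ^ n) ^ 6 * 2 ^ n" by simp
      then obtain d1 d2 d3 d4 where d: "d1 \<in> fvec n" "d1 \<notin> W" "d2 \<in> fvec n" "d2 \<notin> extend d1 W"
        "d3 \<in> fvec n" "d3 \<notin> extend d2 (extend d1 W)"
        "d4 \<in> fvec n" "d4 \<notin> extend d3 (extend d2 (extend d1 W))"
        and big: "1 / 2 * (card A / 2 ^ n) ^ 6 * 2 ^ n \<le> card (six_core A d1 d2 d3 d4)"
        by (rule exists_six_core[OF card2 AG finW W(2)]) auto
      define W' where "W' = extend d4 (extend d3 (extend d2 (extend d1 W)))"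
      \<comment> \<open>Sums of two points of \<open>P'\<close> combine sums from \<open>P\<close>
        with sums of two of the six points, and the latter fill the span of the new
        directions.\<close>
      define P' where "P' = {p + b | p b. p \<in> P \<and> b \<in> six_points d1 d2 d3 d4}"
      have "Inv (Suc k) (six_core A d1 d2 d3 d4)"
        unfolding Inv_def
      proof (intro conjI; (rule exI[of _ W'], rule exI[of _ P'], intro conjI ballI)?)
        show "six_core A d1 d2 d3 d4 \<subseteq> fvec n" using AG by (auto simp: six_core_def)
        have "subspace_dim n W' (Suc (Suc (Suc (Suc (4 * k)))))"
          unfolding W'_def using d by (intro subspace_dim_extend W(1))
        moreover have "Suc (Suc (Suc (Suc (4 * k)))) = 4 * Suc k" by simp
        ultimately show "subspace_dim n W' (4 * Suc k)" by (simp only:)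
        have fin: "finite (extend d U)" if "finite U" for d and U :: "(nat \<Rightarrow> 'a) set"
          using that by (simp add: extend_def)
        have card: "card (extend d U) \<le> 2 * card U" if "finite U" for d and U :: "(nat \<Rightarrow> 'a) set"
          using card_extend[OF that, of d] card2 by simp
        have "card W' \<le> 2 * (2 * (2 * (2 * card W)))"
          unfolding W'_def
          by (intro order_trans[OF card] mult_left_mono card fin finW) auto
        moreover have "(2::nat) ^ (4 * Suc k) = 16 * 2 ^ (4 * k)" by (simp add: power_add)
        ultimately show "card W' \<le> 2 ^ (4 * Suc k)" using W(2) by linarith
      next
        fix x p' assume x: "x \<in> six_core A d1 d2 d3 d4" and "p' \<in> P'"
        then obtain p b where p: "p \<in> P" "b \<in> six_points d1 d2 d3 d4" "p' = p + b"
          by (auto simp: P'_def)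
        have "x + b \<in> A" using x p(2) by (simp add: six_core_def)
        from AP[OF this p(1)] show "x + p' \<in> R" by (simp add: p(3) add_ac)
      next
        fix w' assume "w' \<in> W'"
        then obtain w c1 c2 c3 c4 where w: "w \<in> W"
          "w' = w + vscale c1 d1 + vscale c2 d2 + vscale c3 d3 + vscale c4 d4"
          unfolding W'_def by (elim mem_extendE) auto
        obtain p p' where p: "p \<in> P" "p' \<in> P" "w = p + p'" using WP[OF w(1)] by blast
        obtain b b' where b: "b \<in> six_points d1 d2 d3 d4" "b' \<in> six_points d1 d2 d3 d4"
          "vscale c1 d1 + vscale c2 d2 + vscale c3 d3 + vscale c4 d4 = b + b'"
          by (rule six_points_sums[OF card2])
        have "w' = w + (vscale c1 d1 + vscale c2 d2 + vscale c3 d3 + vscale c4 d4)"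
          unfolding w(2) by (simp only: add.assoc)
        also have "\<dots> = (p + b) + (p' + b')" unfolding b(3) p(3) by (simp only: add_ac)
        finally show "\<exists>p\<in>P'. \<exists>p'\<in>P'. w' = p + p'" using p b unfolding P'_def by blast
      qed
      thus ?thesis using big by (intro exI[of _ "six_core A d1 d2 d3 d4"]) simp
    qed
    obtain A where A: "Inv K A" "0 < card A"
      by (rule density_iteration[where Inv = Inv and N = "2 ^ n" and C = 6 and c = "1 / 2"
          and \<alpha> = "(1 / 2) ^ t", OF _ _ _ _ _ c12 base dens step large]) auto
    then obtain x where x: "x \<in> A" by fastforce
    obtain W P where W: "subspace_dim n W (4 * K)"
      and AP: "\<forall>x\<in>A. \<forall>p\<in>P. x + p \<in> R" and WP: "\<forall>w\<in>W. \<exists>p\<in>P. \<exists>p'\<in>P. w = p + p'"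
      using A(1) unfolding Inv_def by (elim conjE exE)
    note P = AP[rule_format, OF x]
    \<comment> \<open>\<open>4 * K\<close> may exceed \<open>t\<close>, while \<open>meets\<close>
      speaks of \<open>t\<close>-spaces.\<close>
    obtain W' where W': "W' \<subseteq> W" "subspace_dim n W' t" by (rule subspace_dim_le[OF W t(2)])
    obtain v where v: "v \<in> W'" "v \<in> R" using meets[OF W'(2)] by blast
    then obtain p p' where p: "p \<in> P" "p' \<in> P" "v = p + p'" using WP W'(1) by blast
    have xp: "x + p \<in> R" "x + p + v \<in> R"
      using P[OF p(1)] P[OF p(2)] by (simp_all add: p(3) xor)
    have c01: "a \<in> {0, 1}" for a :: 'a
      unfolding CARD_2_UNIV(1)[OF card2, symmetric] by simp
    \<comment> \<open>The line of \<open>v\<close> is \<open>{0, v}\<close>, so membership would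
      make \<open>x + p\<close> or \<open>x + p'\<close> zero, which is not red.\<close>
    have "x + p \<notin> line v"
    proof
      assume "x + p \<in> line v"
      then obtain a where "x + p = vscale a v" unfolding line_def by blast
      hence "x + p = 0 \<or> x + p = v" using c01[of a] by auto
      hence "x + p = 0 \<or> x + p + v = 0" by (auto simp: xor)
      thus False using xp RG(2) by auto
    qed
    moreover have "x + p \<in> fvec n" using xp RG by blast
    ultimately obtain a where a: "x + p + vscale a v \<notin> R"
      using no_red_plane[of n col v "x + p", OF nored'] v(2) unfolding R_def by blast
    show False using c01[of a] a xp by auto
  qed
qed

section \<open>Choice of the ambient dimension\<close>

lemma vramsey_le: "ramsey_prop F s t n \<Longrightarrow> vramsey F s t \<le> n"
  unfolding vramsey_def by (rule Least_le)

theorem theorem1p5: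
  assumes "CARD('a::{field,finite}) = 2" and "CARD('b::{field,finite}) = 3"
  shows "(\<lambda>t. real (vramsey TYPE('a) 2 t)) \<in> O(\<lambda>t. real t * 6 powr (real t / 4)) \<and>
         (\<lambda>t. real (vramsey TYPE('b) 2 t)) \<in> O(\<lambda>t. real t * C0 powr (real t))"
proof
  show "(\<lambda>t. real (vramsey TYPE('a) 2 t)) \<in> O(\<lambda>t. real t * 6 powr (real t / 4))"
  proof (rule bigoI[where c = 21], rule eventually_mono[OF eventually_ge_at_top[of 1]])
    fix t :: nat assume t: "1 \<le> t"
    \<comment> \<open>This gives \<open>t \<le> 4 * K\<close> and costs only a factor 6:
      \<open>6 ^ K \<le> 6 * z\<close>.\<close>
    define K where "K = t div 4 + 1"
    \<comment> \<open>\<open>(t + 1) * 6 ^ K\<close> cancels the density loss in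
      \<open>ramsey_prop_2\<close>; the rest supplies the threshold
      \<open>2 ^ (4 * K + 4)\<close>.\<close>
    define n where "n = (t + 1) * 6 ^ K + 4 * K + 4"
    define z where "z = 6 powr (real t / 4)"
    have "(1 / 2 * (1 / 2) ^ t :: real) powr (6 ^ K) = (1 / 2) ^ ((t + 1) * 6 ^ K)"
    proof -
      have "(1 / 2 * (1 / 2) ^ t :: real) = (1 / 2) ^ (t + 1)" by simp
      moreover have "((1 / 2) ^ (t + 1) :: real) powr real (6 ^ K) = ((1 / 2) ^ (t + 1)) ^ 6 ^ K"
        by (rule powr_realpow) simp
      ultimately show ?thesis by (simp only: power_mult of_nat_power of_nat_numeral)
    qed
    hence "2 ^ (4 * K + 4) \<le> (1 / 2 * (1 / 2) ^ t :: real) powr (6 ^ K) * 2 ^ n"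
      by (simp add: n_def power_add power_one_over)
    hence "vramsey TYPE('a) 2 t \<le> n"
      using t by (intro vramsey_le ramsey_prop_2[OF assms(1), of t K]) (auto simp: K_def)
    hence "real (vramsey TYPE('a) 2 t) \<le> real n" by simp
    also have "real n = (real t + 1) * 6 ^ K + real (4 * (t div 4)) + 8"
      by (simp add: n_def K_def algebra_simps)
    also have "\<dots> \<le> (real t + real t) * (6 * z) + real t * z + 8 * (real t * z)"
    proof -
      have "(6::real) ^ (t div 4) = 6 powr (real (t div 4))" by (simp add: powr_realpow)
      also have "\<dots> \<le> z" unfolding z_def by (intro powr_mono) auto
      finally have "(6::real) ^ K \<le> 6 * z" by (simp add: K_def)
      moreover have z1: "1 \<le> z" by (simp add: z_def ge_one_powr_ge_zero)
      moreover have tz: "real t * 1 \<le> real t * z" using z1 by (intro mult_left_mono) auto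
      moreover have "real (4 * (t div 4)) \<le> real t" by (subst of_nat_le_iff) simp
      moreover have "(real t + 1) * 6 ^ K \<le> (real t + real t) * (6 * z)"
        using \<open>6 ^ K \<le> 6 * z\<close> t by (intro mult_mono) auto
      ultimately show ?thesis using t by linarith
    qed
    also have "\<dots> = 21 * (real t * z)" by simp
    finally show "norm (real (vramsey TYPE('a) 2 t)) \<le> 21 * norm (real t * 6 powr (real t / 4))"
      by (simp add: z_def)
  qed
next
  \<comment> \<open>Taking the constant \<open>c\<close> of \<open>ramsey_prop_3\<close> as a power
    of \<open>1 / 3\<close> makes the whole density loss a power of 3.\<close>
  obtain e where e: "(1 / 3) ^ e < ap_const / 2"
    using real_arch_pow_inv[of "ap_const / 2" "1 / 3"] ap_const_pos by auto
  show "(\<lambda>t. real (vramsey TYPE('b) 2 t)) \<in> O(\<lambda>t. real t * C0 powr (real t))"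
  proof (rule bigoI[where c = "e + 3"], rule eventually_mono[OF eventually_ge_at_top[of 1]])
    fix t :: nat assume t: "1 \<le> t"
    define z where "z = C0 ^ t"
    have z: "z = C0 powr real t" "1 \<le> z"
      using C0_facts(3) by (auto simp: z_def powr_realpow)
    \<comment> \<open>\<open>(e + t) * z\<close> offsets the density loss and the summand
      \<open>t\<close> supplies the threshold \<open>3 ^ t\<close>; rounding up costs at most
      1.\<close>
    define n where "n = nat \<lceil>t + (e + t) * z\<rceil>"
    have "0 \<le> t + (e + t) * z" using z(2) by simp
    hence n: "t + (e + t) * z \<le> n" "real n \<le> t + (e + t) * z + 1"
      unfolding n_def by linarith+
    have "((1 / 3) ^ e * (1 / 3) ^ t :: real) powr z = 3 powr (- ((e + t) * z))"
    proof -
      have "((1 / 3) ^ e * (1 / 3) ^ t :: real) = 3 powr (- real (e + t))"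
        by (simp add: powr_minus powr_realpow power_one_over inverse_eq_divide del: of_nat_add flip: power_add)
      thus ?thesis by (simp only: powr_powr) (simp add: algebra_simps)
    qed
    hence "((1 / 3) ^ e * (1 / 3) ^ t :: real) powr z * 3 ^ n = 3 powr (real n - (e + t) * z)"
      by (simp add: powr_realpow powr_diff powr_minus_divide)
    also have "\<dots> \<ge> 3 powr real t" using n(1) by (intro powr_mono) auto
    finally have "3 ^ t \<le> ((1 / 3) ^ e * (1 / 3) ^ t :: real) powr (C0 ^ t) * 3 ^ n"
      by (simp add: powr_realpow z_def)
    hence "vramsey TYPE('b) 2 t \<le> n"
      using t e by (intro vramsey_le ramsey_prop_3[OF assms(2), of t "(1 / 3) ^ e"]) (auto simp: power_le_one)
    hence "real (vramsey TYPE('b) 2 t) \<le> real n" by simp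
    also have "\<dots> \<le> t + (e + t) * z + 1" by (rule n(2))
    also have "\<dots> \<le> real t * z + (e * (real t * z) + real t * z) + real t * z"
    proof -
      have tz: "real t * 1 \<le> real t * z" using z by (intro mult_left_mono) auto
      have "1 * z \<le> real t * z" using z t by (intro mult_right_mono) auto
      hence "real e * (1 * z) \<le> real e * (real t * z)" by (intro mult_left_mono) auto
      hence "real e * z \<le> real e * (real t * z)" by simp
      moreover have "1 \<le> real t * z" using tz t by linarith
      ultimately show ?thesis using tz unfolding of_nat_add distrib_right by linarith
    qed
    also have "\<dots> = (e + 3) * (real t * z)" by (simp add: algebra_simps)
    finally show "norm (real (vramsey TYPE('b) 2 t)) \<le> (e + 3) * norm (real t * C0 powr (real t))"
      by (simp add: z(1))
  qed
qed

end
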